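(* Let $\mathcal{C}$ be a $k$-linear Krull-Schmidt connective cyclic category, and let $R_1=(Z_1,\phi_1,q_1)$ and $R_2=(Z_2,\phi_2,q_2)$ be two charge triples on $\mathcal{C}$. Suppose that $R_1$ and $R_2$ are deformation equivalent and that $\mathcal{C}$ is liftable with respect to $R_1$. Then $\mathcal{C}$ is also liftable with respect to $R_2$. Moreover, if $\widetilde{\mathcal{C}}_1$ and $\widetilde{\mathcal{C}}_2$ denote the $\mathbb{Z}$-lifts of $\mathcal{C}$ with respect to $R_1$ and $R_2$, with projection functors $\pi_1:\widetilde{\mathcal{C}}_1\to\mathcal{C}$ and $\pi_2:\widetilde{\mathcal{C}}_2\to\mathcal{C}$, there exists a (not canonical) equivalence $H:\widetilde{\mathcal{C}}_1\simeq\widetilde{\mathcal{C}}_2$ such that $\pi_2\circ H=\pi_1$.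
   Context: **Cyclic categories.** A cyclic category is a triangulated category $\mathcal{C}$ with a canonical isomorphism of functors $\beta:[2]\simeq id$. It is always assumed $k$-linear ($k$ a field), Krull-Schmidt (every object is a finite direct sum of indecomposables, uniquely up to isomorphism, and endomorphism rings of indecomposables are local) and essentially small. **Real decompositions.** A real decomposition of $\mathcal{C}$ is a grading $Hom_{\mathcal{C}}(E,F)=\bigoplus_{a\in\mathbb{R}}Hom_a(E,F)$ for all indecomposable $E,F$ such that: (1) $f\in Hom_a(E,F)$ implies $f[1]\in Hom_a(E[1],F[1])$; (2) $f\in Hom_a(E,F)$, $g\in Hom_b(F,G)$ imply $g\circ f\in Hom_{a+b}(E,G)$; (3) $id_E\in Hom_0(E,E)$ and $\beta_E\in Hom_0(E[2],E)$; (4) elements of $Hom_a(E,F)$ are called homogeneous of degree $a$, and every homogeneous isomorphism has degree $0$. The degree function $q$ sends a nonzero homogeneous morphism to its degree. **Connecting paths and liftable diagrams.** A morphism $f:\bigoplus_i A_i\to\bigoplus_j B_j$ ($A_i,B_j$ nontrivial indecomposables) is quasi-homogeneous if all its components $A_i\to B_j$ are homogeneous. A connecting path $l:E_0\dashrightarrow E_n$ is a sequence of indecomposables $E_0,\dots,E_n$ with nonzero homogeneous $f_i$ in $Hom(E_i,E_{i+1})$ (sign $+1$) or in $Hom(E_{i+1},E_i)$ (sign $-1$), $0\le i\le n-1$; $q(l)=\sum_i \mathrm{Sign}(f_i)q(f_i)$. It is a connecting loop if $E_0=E_n$. $\mathcal{C}$ is connective if any two indecomposable objects are joined by a connecting path.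 All commutative diagrams have associated directed graphs without self-loops or multiple edges. In a diagram each object is written as a finite direct sum of nontrivial indecomposables; a connecting path is in a diagram $\mathbf{D}$ with quasi-homogeneous morphisms if each $f_i$ is a component of a morphism of $\mathbf{D}$ (summands at different vertices are regarded as different; loops in $\mathbf{D}$ begin and end at the same summand of the same vertex). A commutative diagram $\mathbf{D}$ is liftable if all its morphisms are quasi-homogeneous and $q(l)=0$ for every connecting loop $l$ in $\mathbf{D}$. It is locally liftable if every sub-diagram whose graph is simply connected is liftable. **Pre-liftability.** $\mathcal{C}$ is pre-liftable with respect to a real decomposition if: (1) every liftable quasi-homogeneous morphism $f:A\to B$ can be completed to a distinguished triangle $A\xrightarrow{f}B\xrightarrow{g}C\xrightarrow{h}A[1]$ such that the infinite diagram $\cdots\to C[-1]\xrightarrow{h[-1]}A\xrightarrow{f}B\xrightarrow{g}C\xrightarrow{h}A[1]\xrightarrow{f[1]}B[1]\to\cdots$ is liftable; (2) whenever distinguished triangles $X\xrightarrow{u}Y\xrightarrow{j}Z'\xrightarrow{k}X[1]$, $X\xrightarrow{v\circ u}Z\xrightarrow{m}Y'\xrightarrow{n}X[1]$, $Y\xrightarrow{v}Z\xrightarrow{l}X'\xrightarrow{i}Y[1]$ (with $id_X$, $id_{X[1]}$ joining the first two) form a liftable commutative diagram, it can be completed, by a distinguished triangle $Z'\xrightarrow{f}Y'\xrightarrow{g}X'\xrightarrow{h}Z'[1]$ and the maps $id_{X'}$ and $j[1]:Y[1]\to Z'[1]$, to a liftable commutative diagram (so $f\circ j=m\circ v$, $g\circ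 m=l$, $h=j[1]\circ i$, $n\circ f=k$). **Charge triples.** A charge triple $R=(Z,\phi,q)$ on $\mathcal{C}$ consists of a central charge $Z:K_0(\mathcal{C})\xrightarrow{v}\Lambda\to\mathbb{C}$ (a homomorphism factoring through a fixed homomorphism $v$ to a lattice $\Lambda$ of finite rank), a map $\phi$ from indecomposable objects to $(0,2]$ and the degree function $q$ of a real decomposition such that: (1) $\phi(E[1])\equiv\phi(E)+1\pmod{2\mathbb{Z}}$; (2) $Z(E)=m(E)e^{i\pi\phi(E)}$, $m(E)\in\mathbb{R}_{\ge0}$, for indecomposable $E$; (3) $q(f)\equiv\phi(E_2)-\phi(E_1)\pmod{2\mathbb{Z}}$ for every nonzero homogeneous $f:E_1\to E_2$ between indecomposables. **Basic loops, Maslov index, liftability.** A fundamental distinguished hexagon is a locally liftable diagram $A\xrightarrow{f}B\xrightarrow{g}C\xrightarrow{h}A[1]\xrightarrow{f[1]}B[1]\xrightarrow{g[1]}C[1]\xrightarrow{\beta_A\circ h[1]}A$, where $A=\bigoplus A_i$, $B=\bigoplus B_j$, $C=\bigoplus C_r$ with indecomposable summands and $A\xrightarrow{f}B\xrightarrow{g}C\xrightarrow{h}A[1]$ is a distinguished triangle. A basic loop is $l=\beta_{A_i}\circ p[1]\circ p$ where $p:A_i\dashrightarrow A_i[1]$ is a connecting path in the diagram of the distinguished triangle; its Maslov index is $M(l)=\frac{q(p)-1}{2}$. $\mathcal{C}$ is liftable with respect to $R=(Z,\phi,q)$ if it is pre-liftable with respect to the real decomposition in $R$ and all Maslov indices of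 basic loops vanish. **Deformation equivalence.** $R_1$ and $R_2$ are deformation equivalent if for any two connecting paths $l_1,l_2:E\dashrightarrow F$, $l_1,l_2$ are homogeneous (consist of homogeneous morphisms) with respect to $R_1$ if and only if they are homogeneous with respect to $R_2$, and moreover $q_1(l_1)-q_1(l_2)=q_2(l_1)-q_2(l_2)$. **$\mathbb{Z}$-lift.** If $\mathcal{C}$ is liftable with respect to $R=(Z,\phi,q)$, its $\mathbb{Z}$-lift $\widetilde{\mathcal{C}}$ is the $k$-linear additive category whose indecomposable objects are pairs $(E,\theta)$ with $E\in\mathcal{C}$ indecomposable, $\theta\in\mathbb{R}$, $\theta\equiv\phi(E)\pmod{2\mathbb{Z}}$ (objects are finite direct sums of these), with $Hom_{\widetilde{\mathcal{C}}}((E_1,\theta_1),(E_2,\theta_2))=Hom_{\theta_2-\theta_1}(E_1,E_2)$ and composition as in $\mathcal{C}$. The functor $\pi:\widetilde{\mathcal{C}}\to\mathcal{C}$ sends $(E,\theta)$ to $E$ and is the inclusion on morphisms. The shift is $(E,\theta)[1]=(E[1],\theta+1)$, acting on morphisms as in $\mathcal{C}$; a triangle in $\widetilde{\mathcal{C}}$ is distinguished if and only if its image under $\pi$ is distinguished. With this structure $\widetilde{\mathcal{C}}$ is a triangulated category. *)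

theory Defs
  imports
    Complex_Main
    "HOL-Library.Real_Mod"
    "HOL-Algebra.Module"
    "HOL-Algebra.Free_Abelian_Groups"
begin

section \<open>Linear categories\<close>

text \<open>
  Composition is written \<open>g \<cdot>\<^bsub>C\<^esub> f\<close> (first \<open>f\<close>, then \<open>g\<close>). The morphism spaces are modules over
  the base field; the ring multiplication that the record \<open>module\<close> also carries is irrelevant.
  Morphism spaces with different ends are not required to be disjoint. A category over arbitrary
  morphism sets is brought into this form by tagging each morphism with its ends.
\<close>

record ('o, 'm, 'k) lincat =
  Obj :: "'o set"
  hom_mod :: "'o \<Rightarrow> 'o \<Rightarrow> ('k, 'm) module"
  ident :: "'o \<Rightarrow> 'm"
  cmp :: "'m \<Rightarrow> 'm \<Rightarrow> 'm"  (infixr \<open>\<cdot>\<index>\<close> 75)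

abbreviation arr :: "('o, 'm, 'k, 'c) lincat_scheme \<Rightarrow> 'o \<Rightarrow> 'o \<Rightarrow> 'm set" where
  "arr C X Y \<equiv> carrier (hom_mod C X Y)"

abbreviation zero_arr :: "('o, 'm, 'k, 'c) lincat_scheme \<Rightarrow> 'o \<Rightarrow> 'o \<Rightarrow> 'm" where
  "zero_arr C X Y \<equiv> \<zero>\<^bsub>hom_mod C X Y\<^esub>"

locale linear_category =
  fixes K :: "('k, 'r) ring_scheme" and C :: "('o, 'm, 'k, 'c) lincat_scheme"
  assumes base_field: "field K"
    and hom_module: "X \<in> Obj C \<Longrightarrow> Y \<in> Obj C \<Longrightarrow> module K (hom_mod C X Y)"
    and ident_closed: "X \<in> Obj C \<Longrightarrow> ident C X \<in> arr C X X"
    and cmp_closed: "\<lbrakk>X \<in> Obj C; Y \<in> Obj C; Z \<in> Obj C; f \<in> arr C X Y; g \<in> arr C Y Z\<rbrakk>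
      \<Longrightarrow> g \<cdot>\<^bsub>C\<^esub> f \<in> arr C X Z"
    and cmp_ident_right: "\<lbrakk>X \<in> Obj C; Y \<in> Obj C; f \<in> arr C X Y\<rbrakk> \<Longrightarrow> f \<cdot>\<^bsub>C\<^esub> ident C X = f"
    and cmp_ident_left: "\<lbrakk>X \<in> Obj C; Y \<in> Obj C; f \<in> arr C X Y\<rbrakk> \<Longrightarrow> ident C Y \<cdot>\<^bsub>C\<^esub> f = f"
    and cmp_assoc: "\<lbrakk>W \<in> Obj C; X \<in> Obj C; Y \<in> Obj C; Z \<in> Obj C;
        f \<in> arr C W X; g \<in> arr C X Y; h \<in> arr C Y Z\<rbrakk>
      \<Longrightarrow> (h \<cdot>\<^bsub>C\<^esub> g) \<cdot>\<^bsub>C\<^esub> f = h \<cdot>\<^bsub>C\<^esub> (g \<cdot>\<^bsub>C\<^esub> f)"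
    and cmp_add_right: "\<lbrakk>X \<in> Obj C; Y \<in> Obj C; Z \<in> Obj C;
        f \<in> arr C X Y; f' \<in> arr C X Y; g \<in> arr C Y Z\<rbrakk>
      \<Longrightarrow> g \<cdot>\<^bsub>C\<^esub> (f \<oplus>\<^bsub>hom_mod C X Y\<^esub> f') = (g \<cdot>\<^bsub>C\<^esub> f) \<oplus>\<^bsub>hom_mod C X Z\<^esub> (g \<cdot>\<^bsub>C\<^esub> f')"
    and cmp_add_left: "\<lbrakk>X \<in> Obj C; Y \<in> Obj C; Z \<in> Obj C;
        f \<in> arr C X Y; g \<in> arr C Y Z; g' \<in> arr C Y Z\<rbrakk>
      \<Longrightarrow> (g \<oplus>\<^bsub>hom_mod C Y Z\<^esub> g') \<cdot>\<^bsub>C\<^esub> f = (g \<cdot>\<^bsub>C\<^esub> f) \<oplus>\<^bsub>hom_mod C X Z\<^esub> (g' \<cdot>\<^bsub>C\<^esub> f)"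
    and cmp_smult_right: "\<lbrakk>X \<in> Obj C; Y \<in> Obj C; Z \<in> Obj C;
        c \<in> carrier K; f \<in> arr C X Y; g \<in> arr C Y Z\<rbrakk>
      \<Longrightarrow> g \<cdot>\<^bsub>C\<^esub> (c \<odot>\<^bsub>hom_mod C X Y\<^esub> f) = c \<odot>\<^bsub>hom_mod C X Z\<^esub> (g \<cdot>\<^bsub>C\<^esub> f)"
    and cmp_smult_left: "\<lbrakk>X \<in> Obj C; Y \<in> Obj C; Z \<in> Obj C;
        c \<in> carrier K; f \<in> arr C X Y; g \<in> arr C Y Z\<rbrakk>
      \<Longrightarrow> (c \<odot>\<^bsub>hom_mod C Y Z\<^esub> g) \<cdot>\<^bsub>C\<^esub> f = c \<odot>\<^bsub>hom_mod C X Z\<^esub> (g \<cdot>\<^bsub>C\<^esub> f)"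

definition is_isom :: "('o, 'm, 'k, 'c) lincat_scheme \<Rightarrow> 'o \<Rightarrow> 'o \<Rightarrow> 'm \<Rightarrow> bool" where
  "is_isom C X Y f \<longleftrightarrow> f \<in> arr C X Y \<and>
     (\<exists>g\<in>arr C Y X. g \<cdot>\<^bsub>C\<^esub> f = ident C X \<and> f \<cdot>\<^bsub>C\<^esub> g = ident C Y)"

definition isomorphic :: "('o, 'm, 'k, 'c) lincat_scheme \<Rightarrow> 'o \<Rightarrow> 'o \<Rightarrow> bool" where
  "isomorphic C X Y \<longleftrightarrow> (\<exists>f. is_isom C X Y f)"

definition zero_object :: "('o, 'm, 'k, 'c) lincat_scheme \<Rightarrow> 'o \<Rightarrow> bool" where
  "zero_object C X \<longleftrightarrow> X \<in> Obj C \<and> ident C X = zero_arr C X X"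

text \<open>\<open>A\<close> is the direct sum of \<open>E 0, \<dots>, E (n - 1)\<close>, with inclusions \<open>\<iota>\<close> and projections \<open>\<rho>\<close>.
  For \<open>n = 0\<close> the last clause says that \<open>A\<close> is a zero object.\<close>

definition biproduct ::
  "('o, 'm, 'k, 'c) lincat_scheme \<Rightarrow> 'o \<Rightarrow> nat \<Rightarrow> (nat \<Rightarrow> 'o) \<Rightarrow> (nat \<Rightarrow> 'm) \<Rightarrow> (nat \<Rightarrow> 'm) \<Rightarrow> bool"
where
  "biproduct C A n E \<iota> \<rho> \<longleftrightarrow> A \<in> Obj C \<and>
     (\<forall>i<n. E i \<in> Obj C \<and> \<iota> i \<in> arr C (E i) A \<and> \<rho> i \<in> arr C A (E i)) \<and>
     (\<forall>i<n. \<forall>j<n. \<rho> j \<cdot>\<^bsub>C\<^esub> \<iota> i = (if i = j then ident C (E i) else zero_arr C (E i) (E j))) \<and>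
     finsum (hom_mod C A A) (\<lambda>i. \<iota> i \<cdot>\<^bsub>C\<^esub> \<rho> i) {..<n} = ident C A"

definition direct_sum_of :: "('o, 'm, 'k, 'c) lincat_scheme \<Rightarrow> 'o \<Rightarrow> 'o list \<Rightarrow> bool" where
  "direct_sum_of C A Es \<longleftrightarrow> (\<exists>\<iota> \<rho>. biproduct C A (length Es) ((!) Es) \<iota> \<rho>)"

locale additive_category = linear_category K C
  for K :: "('k, 'r) ring_scheme" and C :: "('o, 'm, 'k, 'c) lincat_scheme" +
  assumes finite_biproducts: "set Es \<subseteq> Obj C \<Longrightarrow> \<exists>A. direct_sum_of C A Es"

definition indecomposable :: "('o, 'm, 'k, 'c) lincat_scheme \<Rightarrow> 'o \<Rightarrow> bool" where
  "indecomposable C E \<longleftrightarrow> E \<in> Obj C \<and> \<not> zero_object C E \<and>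
     (\<forall>X Y. direct_sum_of C E [X, Y] \<longrightarrow> zero_object C X \<or> zero_object C Y)"

definition end_ring :: "('o, 'm, 'k, 'c) lincat_scheme \<Rightarrow> 'o \<Rightarrow> 'm ring" where
  "end_ring C E = \<lparr>carrier = arr C E E, monoid.mult = cmp C, one = ident C E,
     ring.zero = zero_arr C E E, ring.add = ring.add (hom_mod C E E)\<rparr>"

text \<open>Local in the sense of not necessarily commutative rings.\<close>

definition local_ring :: "('a, 'b) ring_scheme \<Rightarrow> bool" where
  "local_ring R \<longleftrightarrow> ring R \<and> \<one>\<^bsub>R\<^esub> \<noteq> \<zero>\<^bsub>R\<^esub> \<and>
     (\<forall>a\<in>carrier R - Units R. \<forall>b\<in>carrier R - Units R. a \<oplus>\<^bsub>R\<^esub> b \<notin> Units R)"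

definition krull_schmidt :: "('o, 'm, 'k, 'c) lincat_scheme \<Rightarrow> bool" where
  "krull_schmidt C \<longleftrightarrow>
     (\<forall>A\<in>Obj C. \<exists>Es. (\<forall>E\<in>set Es. indecomposable C E) \<and> direct_sum_of C A Es) \<and>
     (\<forall>A Es Fs. (\<forall>E\<in>set Es \<union> set Fs. indecomposable C E) \<and>
        direct_sum_of C A Es \<and> direct_sum_of C A Fs \<longrightarrow>
        (\<exists>s. bij_betw s {..<length Es} {..<length Fs} \<and>
             (\<forall>i<length Es. isomorphic C (Es ! i) (Fs ! s i)))) \<and>
     (\<forall>E. indecomposable C E \<longrightarrow> local_ring (end_ring C E))"


section \<open>Linear functors\<close>

record ('o, 'm, 'p, 'n) functr =
  onO :: "'o \<Rightarrow> 'p"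
  onM :: "'m \<Rightarrow> 'n"

definition linear_functor ::
  "('k, 'r) ring_scheme \<Rightarrow> ('o, 'm, 'k, 'c) lincat_scheme \<Rightarrow> ('p, 'n, 'k, 'd) lincat_scheme
    \<Rightarrow> ('o, 'm, 'p, 'n) functr \<Rightarrow> bool"
where
  "linear_functor K C D F \<longleftrightarrow>
     (\<forall>X\<in>Obj C. onO F X \<in> Obj D \<and> onM F (ident C X) = ident D (onO F X)) \<and>
     (\<forall>X\<in>Obj C. \<forall>Y\<in>Obj C. \<forall>f\<in>arr C X Y. onM F f \<in> arr D (onO F X) (onO F Y)) \<and>
     (\<forall>X\<in>Obj C. \<forall>Y\<in>Obj C. \<forall>Z\<in>Obj C. \<forall>f\<in>arr C X Y. \<forall>g\<in>arr C Y Z.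
        onM F (g \<cdot>\<^bsub>C\<^esub> f) = onM F g \<cdot>\<^bsub>D\<^esub> onM F f) \<and>
     (\<forall>X\<in>Obj C. \<forall>Y\<in>Obj C. \<forall>f\<in>arr C X Y. \<forall>g\<in>arr C X Y.
        onM F (f \<oplus>\<^bsub>hom_mod C X Y\<^esub> g) =
          onM F f \<oplus>\<^bsub>hom_mod D (onO F X) (onO F Y)\<^esub> onM F g) \<and>
     (\<forall>X\<in>Obj C. \<forall>Y\<in>Obj C. \<forall>c\<in>carrier K. \<forall>f\<in>arr C X Y.
        onM F (c \<odot>\<^bsub>hom_mod C X Y\<^esub> f) = c \<odot>\<^bsub>hom_mod D (onO F X) (onO F Y)\<^esub> onM F f)"

definition id_functor :: "('o, 'm, 'o, 'm) functr" where
  "id_functor = \<lparr>onO = id, onM = id\<rparr>"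

definition comp_functor ::
  "('p, 'n, 'q, 'l) functr \<Rightarrow> ('o, 'm, 'p, 'n) functr \<Rightarrow> ('o, 'm, 'q, 'l) functr" where
  "comp_functor G F = \<lparr>onO = onO G \<circ> onO F, onM = onM G \<circ> onM F\<rparr>"

text \<open>Strict equality of functors on \<open>C\<close>.\<close>

definition functor_eq_on ::
  "('o, 'm, 'k, 'c) lincat_scheme \<Rightarrow> ('o, 'm, 'p, 'n) functr \<Rightarrow> ('o, 'm, 'p, 'n) functr \<Rightarrow> bool"
where
  "functor_eq_on C F G \<longleftrightarrow> (\<forall>X\<in>Obj C. onO F X = onO G X) \<and>
     (\<forall>X\<in>Obj C. \<forall>Y\<in>Obj C. \<forall>f\<in>arr C X Y. onM F f = onM G f)"

definition natural_iso ::
  "('o, 'm, 'k, 'c) lincat_scheme \<Rightarrow> ('p, 'n, 'k, 'd) lincat_scheme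
    \<Rightarrow> ('o, 'm, 'p, 'n) functr \<Rightarrow> ('o, 'm, 'p, 'n) functr \<Rightarrow> ('o \<Rightarrow> 'n) \<Rightarrow> bool"
where
  "natural_iso C D F G \<tau> \<longleftrightarrow>
     (\<forall>X\<in>Obj C. is_isom D (onO F X) (onO G X) (\<tau> X)) \<and>
     (\<forall>X\<in>Obj C. \<forall>Y\<in>Obj C. \<forall>f\<in>arr C X Y. \<tau> Y \<cdot>\<^bsub>D\<^esub> onM F f = onM G f \<cdot>\<^bsub>D\<^esub> \<tau> X)"

definition linear_equivalence ::
  "('k, 'r) ring_scheme \<Rightarrow> ('o, 'm, 'k, 'c) lincat_scheme \<Rightarrow> ('p, 'n, 'k, 'd) lincat_scheme
    \<Rightarrow> ('o, 'm, 'p, 'n) functr \<Rightarrow> bool"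
where
  "linear_equivalence K C D F \<longleftrightarrow> linear_functor K C D F \<and>
     (\<exists>G. linear_functor K D C G \<and>
        (\<exists>\<tau>. natural_iso C C (comp_functor G F) id_functor \<tau>) \<and>
        (\<exists>\<tau>. natural_iso D D (comp_functor F G) id_functor \<tau>))"


section \<open>Triangulated and cyclic categories\<close>

text \<open>The shift is an automorphism; \<open>shO C n\<close> and \<open>shM C n\<close> are its powers \<open>[n]\<close> for all integers
  \<open>n\<close> on objects and on morphisms. A triangle \<open>X \<rightarrow> Y \<rightarrow> Z \<rightarrow> X[1]\<close> with maps \<open>f\<close>, \<open>g\<close>, \<open>h\<close> is the
  tuple \<open>(X, Y, Z, f, g, h)\<close>.\<close>

record ('o, 'm, 'k) tricat = "('o, 'm, 'k) lincat" +
  shO :: "int \<Rightarrow> 'o \<Rightarrow> 'o"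
  shM :: "int \<Rightarrow> 'm \<Rightarrow> 'm"
  dist :: "('o \<times> 'o \<times> 'o \<times> 'm \<times> 'm \<times> 'm) set"

definition shift_functor :: "('o, 'm, 'k, 'c) tricat_scheme \<Rightarrow> int \<Rightarrow> ('o, 'm, 'o, 'm) functr" where
  "shift_functor C n = \<lparr>onO = shO C n, onM = shM C n\<rparr>"

definition triangle ::
  "('o, 'm, 'k, 'c) tricat_scheme \<Rightarrow> 'o \<Rightarrow> 'o \<Rightarrow> 'o \<Rightarrow> 'm \<Rightarrow> 'm \<Rightarrow> 'm \<Rightarrow> bool" where
  "triangle C X Y Z f g h \<longleftrightarrow> X \<in> Obj C \<and> Y \<in> Obj C \<and> Z \<in> Obj C \<and>
     f \<in> arr C X Y \<and> g \<in> arr C Y Z \<and> h \<in> arr C Z (shO C 1 X)"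

locale triangulated_category = additive_category K C
  for K :: "('k, 'r) ring_scheme" and C :: "('o, 'm, 'k, 'c) tricat_scheme" +
  assumes shift_linear: "linear_functor K C C (shift_functor C n)"
    and shift_zero: "functor_eq_on C (shift_functor C 0) id_functor"
    and shift_add: "functor_eq_on C (shift_functor C (m + n))
          (comp_functor (shift_functor C m) (shift_functor C n))"
    and dist_triangle: "(X, Y, Z, f, g, h) \<in> dist C \<Longrightarrow> triangle C X Y Z f g h"
    and TR1_ident: "\<lbrakk>X \<in> Obj C; zero_object C N\<rbrakk>
      \<Longrightarrow> (X, X, N, ident C X, zero_arr C X N, zero_arr C N (shO C 1 X)) \<in> dist C"
    and TR1_isom: "\<lbrakk>(X, Y, Z, f, g, h) \<in> dist C; triangle C X' Y' Z' f' g' h';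
        is_isom C X X' a; is_isom C Y Y' b; is_isom C Z Z' c;
        b \<cdot>\<^bsub>C\<^esub> f = f' \<cdot>\<^bsub>C\<^esub> a; c \<cdot>\<^bsub>C\<^esub> g = g' \<cdot>\<^bsub>C\<^esub> b; shM C 1 a \<cdot>\<^bsub>C\<^esub> h = h' \<cdot>\<^bsub>C\<^esub> c\<rbrakk>
      \<Longrightarrow> (X', Y', Z', f', g', h') \<in> dist C"
    and TR1_complete: "\<lbrakk>X \<in> Obj C; Y \<in> Obj C; f \<in> arr C X Y\<rbrakk>
      \<Longrightarrow> \<exists>Z g h. (X, Y, Z, f, g, h) \<in> dist C"
    and TR2: "triangle C X Y Z f g h \<Longrightarrow> (X, Y, Z, f, g, h) \<in> dist C \<longleftrightarrow>
        (Y, Z, shO C 1 X, g, h, \<ominus>\<^bsub>hom_mod C (shO C 1 X) (shO C 1 Y)\<^esub> (shM C 1 f)) \<in> dist C"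
    and TR3: "\<lbrakk>(X, Y, Z, f, g, h) \<in> dist C; (X', Y', Z', f', g', h') \<in> dist C;
        a \<in> arr C X X'; b \<in> arr C Y Y'; b \<cdot>\<^bsub>C\<^esub> f = f' \<cdot>\<^bsub>C\<^esub> a\<rbrakk>
      \<Longrightarrow> \<exists>c\<in>arr C Z Z'. c \<cdot>\<^bsub>C\<^esub> g = g' \<cdot>\<^bsub>C\<^esub> b \<and> shM C 1 a \<cdot>\<^bsub>C\<^esub> h = h' \<cdot>\<^bsub>C\<^esub> c"
    and TR4: "\<lbrakk>(X, Y, Z', u, j, k) \<in> dist C; (Y, Z, X', v, l, i) \<in> dist C;
        (X, Z, Y', v \<cdot>\<^bsub>C\<^esub> u, m', n') \<in> dist C\<rbrakk>
      \<Longrightarrow> \<exists>f g. (Z', Y', X', f, g, shM C 1 j \<cdot>\<^bsub>C\<^esub> i) \<in> dist C \<and>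
            f \<cdot>\<^bsub>C\<^esub> j = m' \<cdot>\<^bsub>C\<^esub> v \<and> n' \<cdot>\<^bsub>C\<^esub> f = k \<and>
            g \<cdot>\<^bsub>C\<^esub> m' = l \<and> i \<cdot>\<^bsub>C\<^esub> g = shM C 1 u \<cdot>\<^bsub>C\<^esub> n'"

record ('o, 'm, 'k) cyccat = "('o, 'm, 'k) tricat" +
  beta :: "'o \<Rightarrow> 'm"

locale cyclic_category = triangulated_category K C
  for K :: "('k, 'r) ring_scheme" and C :: "('o, 'm, 'k, 'c) cyccat_scheme" +
  assumes beta_iso: "natural_iso C C (shift_functor C 2) id_functor (beta C)"

definition triangulated_equivalence ::
  "('k, 'r) ring_scheme \<Rightarrow> ('o, 'm, 'k, 'c) tricat_scheme \<Rightarrow> ('p, 'n, 'k, 'd) tricat_scheme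
    \<Rightarrow> ('o, 'm, 'p, 'n) functr \<Rightarrow> bool"
where
  "triangulated_equivalence K C D F \<longleftrightarrow> linear_equivalence K C D F \<and>
     (\<exists>\<tau>. natural_iso C D (comp_functor F (shift_functor C 1)) (comp_functor (shift_functor D 1) F) \<tau> \<and>
        (\<forall>X Y Z f g h. (X, Y, Z, f, g, h) \<in> dist C \<longrightarrow>
           (onO F X, onO F Y, onO F Z, onM F f, onM F g, \<tau> X \<cdot>\<^bsub>D\<^esub> onM F h) \<in> dist D))"


section \<open>Real decompositions and connecting paths\<close>

text \<open>A grading \<open>G\<close> assigns to \<open>E\<close>, \<open>F\<close>, \<open>a\<close> the set \<open>Hom\<^sub>a(E, F)\<close>; only its values at indecomposable
  \<open>E\<close>, \<open>F\<close> matter.\<close>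

type_synonym ('o, 'm) grading = "'o \<Rightarrow> 'o \<Rightarrow> real \<Rightarrow> 'm set"

definition real_decomposition ::
  "('k, 'r) ring_scheme \<Rightarrow> ('o, 'm, 'k, 'c) cyccat_scheme \<Rightarrow> ('o, 'm) grading \<Rightarrow> bool" where
  "real_decomposition K C G \<longleftrightarrow>
     (\<forall>E F a. indecomposable C E \<and> indecomposable C F \<longrightarrow>
        submodule (G E F a) K (hom_mod C E F)) \<and>
     (\<forall>E F. indecomposable C E \<and> indecomposable C F \<longrightarrow> (\<forall>f\<in>arr C E F.
        \<exists>!d. (\<forall>a. d a \<in> G E F a) \<and> finite {a. d a \<noteq> zero_arr C E F} \<and>
             finsum (hom_mod C E F) d {a. d a \<noteq> zero_arr C E F} = f)) \<and>
     (\<forall>E F a f. indecomposable C E \<and> indecomposable C F \<and> f \<in> G E F a \<longrightarrow>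
        shM C 1 f \<in> G (shO C 1 E) (shO C 1 F) a) \<and>
     (\<forall>E F H a b f g. indecomposable C E \<and> indecomposable C F \<and> indecomposable C H \<and>
        f \<in> G E F a \<and> g \<in> G F H b \<longrightarrow> g \<cdot>\<^bsub>C\<^esub> f \<in> G E H (a + b)) \<and>
     (\<forall>E. indecomposable C E \<longrightarrow> ident C E \<in> G E E 0 \<and> beta C E \<in> G (shO C 2 E) E 0) \<and>
     (\<forall>E F a f. indecomposable C E \<and> indecomposable C F \<and> f \<in> G E F a \<and> is_isom C E F f
        \<longrightarrow> a = 0)"

definition homogeneous :: "('o, 'm) grading \<Rightarrow> 'o \<Rightarrow> 'o \<Rightarrow> 'm \<Rightarrow> bool" where
  "homogeneous G E F f \<longleftrightarrow> (\<exists>a. f \<in> G E F a)"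

text \<open>The degree function \<open>q\<close>; it is meaningful for nonzero homogeneous morphisms.\<close>

definition deg :: "('o, 'm) grading \<Rightarrow> 'o \<Rightarrow> 'o \<Rightarrow> 'm \<Rightarrow> real" where
  "deg G E F f = (THE a. f \<in> G E F a)"

text \<open>A step \<open>(E, E', s, f)\<close> leads from \<open>E\<close> to \<open>E'\<close>. The morphism \<open>f\<close> goes from \<open>E\<close> to \<open>E'\<close> if \<open>s\<close> holds
  (sign \<open>+1\<close>) and from \<open>E'\<close> to \<open>E\<close> otherwise (sign \<open>-1\<close>). The list \<open>[]\<close> is the path of length 0.\<close>

type_synonym ('o, 'm) step = "'o \<times> 'o \<times> bool \<times> 'm"

fun zigzag :: "('o, 'm, 'k, 'c) lincat_scheme \<Rightarrow> 'o \<Rightarrow> ('o, 'm) step list \<Rightarrow> 'o \<Rightarrow> bool" where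
  "zigzag C E [] F \<longleftrightarrow> indecomposable C E \<and> E = F"
| "zigzag C E ((A, B, s, f) # l) F \<longleftrightarrow> indecomposable C E \<and> A = E \<and> indecomposable C B \<and>
     (if s then f \<in> arr C A B \<and> f \<noteq> zero_arr C A B
      else f \<in> arr C B A \<and> f \<noteq> zero_arr C B A) \<and> zigzag C B l F"

definition homogeneous_path :: "('o, 'm) grading \<Rightarrow> ('o, 'm) step list \<Rightarrow> bool" where
  "homogeneous_path G l \<longleftrightarrow>
     (\<forall>(A, B, s, f)\<in>set l. if s then homogeneous G A B f else homogeneous G B A f)"

definition connecting_path ::
  "('o, 'm, 'k, 'c) lincat_scheme \<Rightarrow> ('o, 'm) grading \<Rightarrow> 'o \<Rightarrow> ('o, 'm) step list \<Rightarrow> 'o \<Rightarrow> bool" where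
  "connecting_path C G E l F \<longleftrightarrow> zigzag C E l F \<and> homogeneous_path G l"

definition path_deg :: "('o, 'm) grading \<Rightarrow> ('o, 'm) step list \<Rightarrow> real" where
  "path_deg G l = (\<Sum>(A, B, s, f)\<leftarrow>l. if s then deg G A B f else - deg G B A f)"

definition connective :: "('o, 'm, 'k, 'c) lincat_scheme \<Rightarrow> ('o, 'm) grading \<Rightarrow> bool" where
  "connective C G \<longleftrightarrow> (\<forall>E F. indecomposable C E \<and> indecomposable C F \<longrightarrow>
     (\<exists>l. connecting_path C G E l F))"


section \<open>Diagrams\<close>

text \<open>An object together with a presentation as a finite direct sum. Each entry \<open>(E, \<iota>, \<rho>)\<close> of
  \<open>parts\<close> consists of a summand, its inclusion and its projection.\<close>

record ('o, 'm) dobj =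
  tot :: 'o
  parts :: "('o \<times> 'm \<times> 'm) list"

definition summand :: "('o, 'm) dobj \<Rightarrow> nat \<Rightarrow> 'o" where
  "summand X i = fst (parts X ! i)"

definition inc :: "('o, 'm) dobj \<Rightarrow> nat \<Rightarrow> 'm" where
  "inc X i = fst (snd (parts X ! i))"

definition prj :: "('o, 'm) dobj \<Rightarrow> nat \<Rightarrow> 'm" where
  "prj X i = snd (snd (parts X ! i))"

definition decomposed :: "('o, 'm, 'k, 'c) lincat_scheme \<Rightarrow> ('o, 'm) dobj \<Rightarrow> bool" where
  "decomposed C X \<longleftrightarrow> (\<forall>i<length (parts X). indecomposable C (summand X i)) \<and>
     biproduct C (tot X) (length (parts X)) (summand X) (inc X) (prj X)"

definition shD :: "('o, 'm, 'k, 'c) tricat_scheme \<Rightarrow> int \<Rightarrow> ('o, 'm) dobj \<Rightarrow> ('o, 'm) dobj" where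
  "shD C n X = \<lparr>tot = shO C n (tot X),
     parts = map (\<lambda>(E, \<iota>, \<rho>). (shO C n E, shM C n \<iota>, shM C n \<rho>)) (parts X)\<rparr>"

definition component ::
  "('o, 'm, 'k, 'c) lincat_scheme \<Rightarrow> ('o, 'm) dobj \<Rightarrow> ('o, 'm) dobj \<Rightarrow> 'm \<Rightarrow> nat \<Rightarrow> nat \<Rightarrow> 'm" where
  "component C X Y f i j = prj Y j \<cdot>\<^bsub>C\<^esub> (f \<cdot>\<^bsub>C\<^esub> inc X i)"

definition quasi_homogeneous ::
  "('o, 'm, 'k, 'c) lincat_scheme \<Rightarrow> ('o, 'm) grading \<Rightarrow> ('o, 'm) dobj \<Rightarrow> ('o, 'm) dobj \<Rightarrow> 'm \<Rightarrow> bool"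
where
  "quasi_homogeneous C G X Y f \<longleftrightarrow> (\<forall>i<length (parts X). \<forall>j<length (parts Y).
     homogeneous G (summand X i) (summand Y j) (component C X Y f i j))"

record ('v, 'o, 'm) diagram =
  verts :: "'v set"
  edges :: "('v \<times> 'v) set"
  obj_at :: "'v \<Rightarrow> ('o, 'm) dobj"
  mor_at :: "'v \<times> 'v \<Rightarrow> 'm"

definition wf_diagram ::
  "('o, 'm, 'k, 'c) lincat_scheme \<Rightarrow> ('v, 'o, 'm) diagram \<Rightarrow> bool" where
  "wf_diagram C D \<longleftrightarrow> edges D \<subseteq> verts D \<times> verts D \<and> irrefl (edges D) \<and>
     (\<forall>v\<in>verts D. decomposed C (obj_at D v)) \<and>
     (\<forall>(v, w)\<in>edges D. mor_at D (v, w) \<in> arr C (tot (obj_at D v)) (tot (obj_at D w)))"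

fun composite :: "('o, 'm, 'k, 'c) lincat_scheme \<Rightarrow> ('v, 'o, 'm) diagram \<Rightarrow> 'v list \<Rightarrow> 'm" where
  "composite C D [] = undefined"
| "composite C D [v] = ident C (tot (obj_at D v))"
| "composite C D (v # w # vs) = composite C D (w # vs) \<cdot>\<^bsub>C\<^esub> mor_at D (v, w)"

definition directed_path :: "('v, 'o, 'm) diagram \<Rightarrow> 'v list \<Rightarrow> bool" where
  "directed_path D vs \<longleftrightarrow> vs \<noteq> [] \<and> set vs \<subseteq> verts D \<and> distinct vs \<and>
     successively (\<lambda>v w. (v, w) \<in> edges D) vs"

text \<open>Commutativity compares directed paths without repeated vertices. For graphs without directed
  cycles these are all directed paths; in a hexagon, the trivial path at a vertex is not compared
  with the full turn.\<close>

definition commutative :: "('o, 'm, 'k, 'c) lincat_scheme \<Rightarrow> ('v, 'o, 'm) diagram \<Rightarrow> bool" where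
  "commutative C D \<longleftrightarrow> wf_diagram C D \<and>
     (\<forall>vs ws. directed_path D vs \<and> directed_path D ws \<and> hd vs = hd ws \<and> last vs = last ws
        \<longrightarrow> composite C D vs = composite C D ws)"

text \<open>\<open>path_in C D x l y\<close>: the steps \<open>l\<close> form a connecting path in \<open>D\<close> from \<open>x\<close> to \<open>y\<close>, where a pair
  \<open>(v, i)\<close> stands for the \<open>i\<close>-th summand of the object at the vertex \<open>v\<close>.\<close>

inductive path_in ::
  "('o, 'm, 'k, 'c) lincat_scheme \<Rightarrow> ('v, 'o, 'm) diagram
    \<Rightarrow> 'v \<times> nat \<Rightarrow> ('o, 'm) step list \<Rightarrow> 'v \<times> nat \<Rightarrow> bool"
  for C D where
  path_in_nil: "v \<in> verts D \<Longrightarrow> i < length (parts (obj_at D v)) \<Longrightarrow> path_in C D (v, i) [] (v, i)"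
| path_in_forward: "\<lbrakk>(v, w) \<in> edges D; X = obj_at D v; Y = obj_at D w;
     i < length (parts X); j < length (parts Y);
     f = component C X Y (mor_at D (v, w)) i j; f \<noteq> zero_arr C (summand X i) (summand Y j);
     path_in C D (w, j) l y\<rbrakk>
   \<Longrightarrow> path_in C D (v, i) ((summand X i, summand Y j, True, f) # l) y"
| path_in_backward: "\<lbrakk>(w, v) \<in> edges D; X = obj_at D v; Y = obj_at D w;
     i < length (parts X); j < length (parts Y);
     f = component C Y X (mor_at D (w, v)) j i; f \<noteq> zero_arr C (summand Y j) (summand X i);
     path_in C D (w, j) l y\<rbrakk>
   \<Longrightarrow> path_in C D (v, i) ((summand X i, summand Y j, False, f) # l) y"

definition liftable_diagram ::
  "('o, 'm, 'k, 'c) lincat_scheme \<Rightarrow> ('o, 'm) grading \<Rightarrow> ('v, 'o, 'm) diagram \<Rightarrow> bool" where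
  "liftable_diagram C G D \<longleftrightarrow> commutative C D \<and>
     (\<forall>(v, w)\<in>edges D. quasi_homogeneous C G (obj_at D v) (obj_at D w) (mor_at D (v, w))) \<and>
     (\<forall>x l. path_in C D x l x \<longrightarrow> path_deg G l = 0)"

text \<open>A graph, seen as a topological space, is simply connected iff it is a tree, i.e. it is nonempty
  and connected and every edge is a bridge.\<close>

definition simply_connected_graph :: "'v set \<Rightarrow> ('v \<times> 'v) set \<Rightarrow> bool" where
  "simply_connected_graph V E \<longleftrightarrow> V \<noteq> {} \<and>
     (\<forall>v\<in>V. \<forall>w\<in>V. (v, w) \<in> (E \<union> E\<inverse>)\<^sup>*) \<and>
     (\<forall>(v, w)\<in>E. (v, w) \<notin> ((E - {(v, w)}) \<union> (E - {(v, w)})\<inverse>)\<^sup>*)"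

definition locally_liftable_diagram ::
  "('o, 'm, 'k, 'c) lincat_scheme \<Rightarrow> ('o, 'm) grading \<Rightarrow> ('v, 'o, 'm) diagram \<Rightarrow> bool" where
  "locally_liftable_diagram C G D \<longleftrightarrow> commutative C D \<and>
     (\<forall>V E. V \<subseteq> verts D \<and> E \<subseteq> edges D \<inter> (V \<times> V) \<and> simply_connected_graph V E \<longrightarrow>
        liftable_diagram C G (D\<lparr>verts := V, edges := E\<rparr>))"

text \<open>The diagram with vertices \<open>0, 1, \<dots>\<close> carrying the listed objects and with the listed edges.\<close>

definition mk_diagram ::
  "('o, 'm) dobj list \<Rightarrow> ((nat \<times> nat) \<times> 'm) list \<Rightarrow> (nat, 'o, 'm) diagram" where
  "mk_diagram Xs es = \<lparr>verts = {..<length Xs}, edges = fst ` set es,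
     obj_at = (\<lambda>v. Xs ! v), mor_at = (\<lambda>e. the (map_of es e))\<rparr>"


section \<open>Pre-liftability\<close>

text \<open>The diagram \<open>\<cdots> \<rightarrow> A[n] \<rightarrow> B[n] \<rightarrow> Z[n] \<rightarrow> A[n+1] \<rightarrow> \<cdots>\<close>, with \<open>A[n]\<close> at the vertex \<open>3 n\<close>.\<close>

definition infinite_diagram ::
  "('o, 'm, 'k, 'c) tricat_scheme \<Rightarrow> ('o, 'm) dobj \<Rightarrow> ('o, 'm) dobj \<Rightarrow> ('o, 'm) dobj
    \<Rightarrow> 'm \<Rightarrow> 'm \<Rightarrow> 'm \<Rightarrow> (int, 'o, 'm) diagram"
where
  "infinite_diagram C A B Z f g h = \<lparr>verts = UNIV, edges = {(n, n + 1) | n. True},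
     obj_at = (\<lambda>n. shD C (n div 3) ([A, B, Z] ! nat (n mod 3))),
     mor_at = (\<lambda>(n, _). shM C (n div 3) ([f, g, h] ! nat (n mod 3)))\<rparr>"

text \<open>The octahedral diagram
  \<open>X \<rightarrow>u Y  \<rightarrow>j  Z' \<rightarrow>k X[1]\<close> (row 1, vertices 0, 1, 2, 3),
  \<open>X \<rightarrow>vu Z \<rightarrow>m' Y' \<rightarrow>n' X[1]\<close> (row 2, vertices 4, 5, 6, 7),
  \<open>Y \<rightarrow>v Z \<rightarrow>l X' \<rightarrow>i Y[1]\<close> (column, vertices 1, 5, 8, 9),
  and the new column \<open>Z' \<rightarrow>f Y' \<rightarrow>g X' \<rightarrow>h Z'[1]\<close> (vertices 2, 6, 10, 11).\<close>

definition octahedron_start ::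
  "('o, 'm, 'k, 'c) tricat_scheme
    \<Rightarrow> ('o, 'm) dobj \<Rightarrow> ('o, 'm) dobj \<Rightarrow> ('o, 'm) dobj
    \<Rightarrow> ('o, 'm) dobj \<Rightarrow> ('o, 'm) dobj \<Rightarrow> ('o, 'm) dobj
    \<Rightarrow> 'm \<Rightarrow> 'm \<Rightarrow> 'm \<Rightarrow> 'm \<Rightarrow> 'm \<Rightarrow> 'm \<Rightarrow> 'm \<Rightarrow> 'm
    \<Rightarrow> (nat, 'o, 'm) diagram"
where
  "octahedron_start C X Y Z X' Y' Z' u v j k m' n' l i = mk_diagram
     [X, Y, Z', shD C 1 X, X, Z, Y', shD C 1 X, X', shD C 1 Y]
     [((0, 1), u), ((1, 2), j), ((2, 3), k),
      ((4, 5), v \<cdot>\<^bsub>C\<^esub> u), ((5, 6), m'), ((6, 7), n'),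
      ((1, 5), v), ((5, 8), l), ((8, 9), i),
      ((0, 4), ident C (tot X)), ((3, 7), ident C (shO C 1 (tot X)))]"

definition octahedron ::
  "('o, 'm, 'k, 'c) tricat_scheme
    \<Rightarrow> ('o, 'm) dobj \<Rightarrow> ('o, 'm) dobj \<Rightarrow> ('o, 'm) dobj
    \<Rightarrow> ('o, 'm) dobj \<Rightarrow> ('o, 'm) dobj \<Rightarrow> ('o, 'm) dobj
    \<Rightarrow> 'm \<Rightarrow> 'm \<Rightarrow> 'm \<Rightarrow> 'm \<Rightarrow> 'm \<Rightarrow> 'm \<Rightarrow> 'm \<Rightarrow> 'm
    \<Rightarrow> 'm \<Rightarrow> 'm \<Rightarrow> 'm \<Rightarrow> (nat, 'o, 'm) diagram"
where
  "octahedron C X Y Z X' Y' Z' u v j k m' n' l i f g h = mk_diagram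
     [X, Y, Z', shD C 1 X, X, Z, Y', shD C 1 X, X', shD C 1 Y, X', shD C 1 Z']
     [((0, 1), u), ((1, 2), j), ((2, 3), k),
      ((4, 5), v \<cdot>\<^bsub>C\<^esub> u), ((5, 6), m'), ((6, 7), n'),
      ((1, 5), v), ((5, 8), l), ((8, 9), i),
      ((0, 4), ident C (tot X)), ((3, 7), ident C (shO C 1 (tot X))),
      ((2, 6), f), ((6, 10), g), ((10, 11), h),
      ((8, 10), ident C (tot X')), ((9, 11), shM C 1 j)]"

definition pre_liftable ::
  "('o, 'm, 'k, 'c) tricat_scheme \<Rightarrow> ('o, 'm) grading \<Rightarrow> bool" where
  "pre_liftable C G \<longleftrightarrow>
     (\<forall>A B f. liftable_diagram C G (mk_diagram [A, B] [((0, 1), f)]) \<longrightarrow>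
        (\<exists>Z g h. decomposed C Z \<and> (tot A, tot B, tot Z, f, g, h) \<in> dist C \<and>
           liftable_diagram C G (infinite_diagram C A B Z f g h))) \<and>
     (\<forall>X Y Z X' Y' Z' u v j k m' n' l i.
        (tot X, tot Y, tot Z', u, j, k) \<in> dist C \<and>
        (tot X, tot Z, tot Y', v \<cdot>\<^bsub>C\<^esub> u, m', n') \<in> dist C \<and>
        (tot Y, tot Z, tot X', v, l, i) \<in> dist C \<and>
        liftable_diagram C G (octahedron_start C X Y Z X' Y' Z' u v j k m' n' l i) \<longrightarrow>
        (\<exists>f g h. (tot Z', tot Y', tot X', f, g, h) \<in> dist C \<and>
           liftable_diagram C G (octahedron C X Y Z X' Y' Z' u v j k m' n' l i f g h)))"


section \<open>Charge triples\<close>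

definition K0_relations :: "('o, 'm, 'k, 'c) tricat_scheme \<Rightarrow> ('o \<Rightarrow>\<^sub>0 int) set" where
  "K0_relations C = generate (free_Abelian_group (Obj C))
     {frag_of Y - frag_of X - frag_of Z | X Y Z f g h. (X, Y, Z, f, g, h) \<in> dist C}"

definition K0 :: "('o, 'm, 'k, 'c) tricat_scheme \<Rightarrow> ('o \<Rightarrow>\<^sub>0 int) set monoid" where
  "K0 C = free_Abelian_group (Obj C) Mod K0_relations C"

definition K0_class :: "('o, 'm, 'k, 'c) tricat_scheme \<Rightarrow> 'o \<Rightarrow> ('o \<Rightarrow>\<^sub>0 int) set" where
  "K0_class C E = K0_relations C #>\<^bsub>free_Abelian_group (Obj C)\<^esub> frag_of E"

definition lattice_group :: "('l, 'x) monoid_scheme \<Rightarrow> bool" where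
  "lattice_group L \<longleftrightarrow> comm_group L \<and> (\<exists>n::nat. L \<cong> free_Abelian_group {..<n})"

definition complex_add_group :: "complex monoid" where
  "complex_add_group = \<lparr>carrier = UNIV, monoid.mult = (+), one = 0\<rparr>"

text \<open>\<open>Z\<close> factors through \<open>v : K\<^sub>0(C) \<rightarrow> L\<close>.\<close>

definition central_charge ::
  "('o, 'm, 'k, 'c) tricat_scheme \<Rightarrow> ('l, 'x) monoid_scheme \<Rightarrow> (('o \<Rightarrow>\<^sub>0 int) set \<Rightarrow> 'l)
    \<Rightarrow> (('o \<Rightarrow>\<^sub>0 int) set \<Rightarrow> complex) \<Rightarrow> bool"
where
  "central_charge C L v Z \<longleftrightarrow> (\<exists>W\<in>hom L complex_add_group. \<forall>x\<in>carrier (K0 C). Z x = W (v x))"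

text \<open>The third entry of a charge triple is stored as the grading, which determines the degree
  function \<open>q = deg (gr R)\<close> and the class of morphisms on which it is defined.\<close>

record ('o, 'm) charge_triple =
  charge :: "('o \<Rightarrow>\<^sub>0 int) set \<Rightarrow> complex"
  phase :: "'o \<Rightarrow> real"
  gr :: "('o, 'm) grading"

definition is_charge_triple ::
  "('k, 'r) ring_scheme \<Rightarrow> ('o, 'm, 'k, 'c) cyccat_scheme \<Rightarrow> ('l, 'x) monoid_scheme
    \<Rightarrow> (('o \<Rightarrow>\<^sub>0 int) set \<Rightarrow> 'l) \<Rightarrow> ('o, 'm) charge_triple \<Rightarrow> bool"
where
  "is_charge_triple K C L v R \<longleftrightarrow>
     central_charge C L v (charge R) \<and>
     (\<forall>E. indecomposable C E \<longrightarrow> phase R E \<in> {0<..2}) \<and>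
     real_decomposition K C (gr R) \<and>
     (\<forall>E. indecomposable C E \<longrightarrow> [phase R (shO C 1 E) = phase R E + 1] (rmod 2)) \<and>
     (\<forall>E. indecomposable C E \<longrightarrow>
        (\<exists>r\<ge>0. charge R (K0_class C E) = complex_of_real r * cis (pi * phase R E))) \<and>
     (\<forall>E F f. indecomposable C E \<and> indecomposable C F \<and> f \<in> arr C E F \<and>
        f \<noteq> zero_arr C E F \<and> homogeneous (gr R) E F f \<longrightarrow>
        [deg (gr R) E F f = phase R F - phase R E] (rmod 2))"


section \<open>Liftability and deformation equivalence\<close>

definition triangle_diagram ::
  "('o, 'm, 'k, 'c) tricat_scheme \<Rightarrow> ('o, 'm) dobj \<Rightarrow> ('o, 'm) dobj \<Rightarrow> ('o, 'm) dobj
    \<Rightarrow> 'm \<Rightarrow> 'm \<Rightarrow> 'm \<Rightarrow> (nat, 'o, 'm) diagram"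
where
  "triangle_diagram C A B Z f g h =
     mk_diagram [A, B, Z, shD C 1 A] [((0, 1), f), ((1, 2), g), ((2, 3), h)]"

definition hexagon_diagram ::
  "('o, 'm, 'k, 'c) cyccat_scheme \<Rightarrow> ('o, 'm) dobj \<Rightarrow> ('o, 'm) dobj \<Rightarrow> ('o, 'm) dobj
    \<Rightarrow> 'm \<Rightarrow> 'm \<Rightarrow> 'm \<Rightarrow> (nat, 'o, 'm) diagram"
where
  "hexagon_diagram C A B Z f g h =
     mk_diagram [A, B, Z, shD C 1 A, shD C 1 B, shD C 1 Z]
       [((0, 1), f), ((1, 2), g), ((2, 3), h), ((3, 4), shM C 1 f), ((4, 5), shM C 1 g),
        ((5, 0), beta C (tot A) \<cdot>\<^bsub>C\<^esub> shM C 1 h)]"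

definition fundamental_hexagon ::
  "('o, 'm, 'k, 'c) cyccat_scheme \<Rightarrow> ('o, 'm) grading
    \<Rightarrow> ('o, 'm) dobj \<Rightarrow> ('o, 'm) dobj \<Rightarrow> ('o, 'm) dobj \<Rightarrow> 'm \<Rightarrow> 'm \<Rightarrow> 'm \<Rightarrow> bool"
where
  "fundamental_hexagon C G A B Z f g h \<longleftrightarrow>
     (tot A, tot B, tot Z, f, g, h) \<in> dist C \<and>
     locally_liftable_diagram C G (hexagon_diagram C A B Z f g h)"

definition shift_path ::
  "('o, 'm, 'k, 'c) tricat_scheme \<Rightarrow> ('o, 'm) step list \<Rightarrow> ('o, 'm) step list" where
  "shift_path C l = map (\<lambda>(E, F, s, f). (shO C 1 E, shO C 1 F, s, shM C 1 f)) l"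

text \<open>\<open>basic_loop C G l p\<close>: the loop \<open>l\<close> is basic, and it arises from the path \<open>p\<close> from a summand
  \<open>A\<^sub>i\<close> to \<open>A\<^sub>i[1]\<close>.\<close>

definition basic_loop ::
  "('o, 'm, 'k, 'c) cyccat_scheme \<Rightarrow> ('o, 'm) grading
    \<Rightarrow> ('o, 'm) step list \<Rightarrow> ('o, 'm) step list \<Rightarrow> bool"
where
  "basic_loop C G l p \<longleftrightarrow> (\<exists>A B Z f g h i. fundamental_hexagon C G A B Z f g h \<and>
     path_in C (triangle_diagram C A B Z f g h) (0, i) p (3, i) \<and>
     l = p @ shift_path C p @
         [(shO C 2 (summand A i), summand A i, True, beta C (summand A i))])"

definition maslov_index :: "('o, 'm) grading \<Rightarrow> ('o, 'm) step list \<Rightarrow> real" where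
  "maslov_index G p = (path_deg G p - 1) / 2"

definition liftable :: "('o, 'm, 'k, 'c) cyccat_scheme \<Rightarrow> ('o, 'm) charge_triple \<Rightarrow> bool" where
  "liftable C R \<longleftrightarrow> pre_liftable C (gr R) \<and>
     (\<forall>l p. basic_loop C (gr R) l p \<longrightarrow> maslov_index (gr R) p = 0)"

text \<open>Here \<open>l\<close> and \<open>l'\<close> range over all zigzags of nonzero morphisms between indecomposables.\<close>

definition deformation_equivalent ::
  "('o, 'm, 'k, 'c) lincat_scheme \<Rightarrow> ('o, 'm) charge_triple \<Rightarrow> ('o, 'm) charge_triple \<Rightarrow> bool" where
  "deformation_equivalent C R\<^sub>1 R\<^sub>2 \<longleftrightarrow>
     (\<forall>E F l l'. zigzag C E l F \<and> zigzag C E l' F \<longrightarrow>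
        (homogeneous_path (gr R\<^sub>1) l \<and> homogeneous_path (gr R\<^sub>1) l' \<longleftrightarrow>
         homogeneous_path (gr R\<^sub>2) l \<and> homogeneous_path (gr R\<^sub>2) l') \<and>
        (homogeneous_path (gr R\<^sub>1) l \<and> homogeneous_path (gr R\<^sub>1) l' \<longrightarrow>
         path_deg (gr R\<^sub>1) l - path_deg (gr R\<^sub>1) l' = path_deg (gr R\<^sub>2) l - path_deg (gr R\<^sub>2) l'))"


section \<open>The \<open>\<int>\<close>-lift\<close>

text \<open>An object of the \<open>\<int>\<close>-lift is a finite direct sum of pairs \<open>(E, \<theta>)\<close>. It is stored as the
  underlying direct sum in \<open>C\<close> with its inclusions and projections, and the list of the \<open>\<theta>\<close>'s.
  A morphism is a morphism in \<open>C\<close> whose components lie in \<open>Hom\<^bsub>\<eta> - \<theta>\<^esub>(E, F)\<close>. In this way the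
  projection to \<open>C\<close> is defined, and commutes with shifts, on the nose.\<close>

type_synonym ('o, 'm) lobj = "('o, 'm) dobj \<times> real list"

definition lift_obj ::
  "('o, 'm, 'k, 'c) tricat_scheme \<Rightarrow> ('o, 'm) charge_triple \<Rightarrow> ('o, 'm) lobj set" where
  "lift_obj C R = {(X, \<theta>). decomposed C X \<and> length \<theta> = length (parts X) \<and>
     (\<forall>i<length \<theta>. [\<theta> ! i = phase R (summand X i)] (rmod 2))}"

definition lift_arr ::
  "('o, 'm, 'k, 'c) tricat_scheme \<Rightarrow> ('o, 'm) charge_triple \<Rightarrow> ('o, 'm) lobj \<Rightarrow> ('o, 'm) lobj \<Rightarrow> 'm set"
where
  "lift_arr C R = (\<lambda>(X, \<theta>) (Y, \<eta>). {f \<in> arr C (tot X) (tot Y).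
     \<forall>i<length (parts X). \<forall>j<length (parts Y).
       component C X Y f i j \<in> gr R (summand X i) (summand Y j) (\<eta> ! j - \<theta> ! i)})"

definition lift_sh :: "('o, 'm, 'k, 'c) tricat_scheme \<Rightarrow> int \<Rightarrow> ('o, 'm) lobj \<Rightarrow> ('o, 'm) lobj" where
  "lift_sh C n = (\<lambda>(X, \<theta>). (shD C n X, map (\<lambda>t. t + of_int n) \<theta>))"

definition zlift ::
  "('o, 'm, 'k, 'c) tricat_scheme \<Rightarrow> ('o, 'm) charge_triple \<Rightarrow> (('o, 'm) lobj, 'm, 'k) tricat" where
  "zlift C R = \<lparr>
     Obj = lift_obj C R,
     hom_mod = (\<lambda>X Y. (hom_mod C (tot (fst X)) (tot (fst Y)))\<lparr>carrier := lift_arr C R X Y\<rparr>),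
     ident = (\<lambda>X. ident C (tot (fst X))),
     cmp = cmp C,
     shO = lift_sh C,
     shM = shM C,
     dist = {(X, Y, Z, f, g, h).
       X \<in> lift_obj C R \<and> Y \<in> lift_obj C R \<and> Z \<in> lift_obj C R \<and>
       f \<in> lift_arr C R X Y \<and> g \<in> lift_arr C R Y Z \<and> h \<in> lift_arr C R Z (lift_sh C 1 X) \<and>
       (tot (fst X), tot (fst Y), tot (fst Z), f, g, h) \<in> dist C}\<rparr>"

text \<open>The projection functor from the \<open>\<int>\<close>-lift to \<open>C\<close>.\<close>

definition lift_proj :: "(('o, 'm) lobj, 'm, 'o, 'm) functr" where
  "lift_proj = \<lparr>onO = (\<lambda>X. tot (fst X)), onM = id\<rparr>"

end

(*
  A nonzero morphism between indecomposables is homogeneous for R1 iff it is for R2, and loops have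
  the same degree for both: apply deformation equivalence to a path of length one, and to a loop and
  the trivial path. Hence the liftable diagrams are the same. A path p from E to E[1] is half of the
  loop that runs through p, p[1] and beta, so it also has the same degree for both, and the Maslov
  indices agree.

  Comparing degrees along paths from a base object gives a function delta on indecomposables with
  q2(f) = q1(f) + delta(F) - delta(E) for f : E -> F. By the above it is invariant under [1], and the
  additive constant can be chosen so that phi2 = phi1 + delta modulo 2. The equivalence sends
  (E, theta) to (E, theta + delta(E)) and is the identity on morphisms.
*)

theory Submission
  imports Defs
begin

section \<open>Linear categories and functors\<close>

context linear_category
begin

lemma hom_abelian_group: "X \<in> Obj C \<Longrightarrow> Y \<in> Obj C \<Longrightarrow> abelian_group (hom_mod C X Y)"
  using hom_module module.axioms(2) by blast

text \<open>Cancellation in the additive group of morphisms; it turns additivity of composition and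
  of functors into preservation of zero.\<close>

lemma zero_arr_unique:
  assumes "X \<in> Obj C" "Y \<in> Obj C" "f \<in> arr C X Y" "f \<oplus>\<^bsub>hom_mod C X Y\<^esub> f = f"
  shows "f = zero_arr C X Y"
proof -
  interpret abelian_group "hom_mod C X Y" using hom_abelian_group assms by blast
  show ?thesis using assms(3,4) by (metis add.l_cancel_one')
qed

lemma cmp_zero_left:
  assumes "X \<in> Obj C" "Y \<in> Obj C" "Z \<in> Obj C" "f \<in> arr C X Y"
  shows "zero_arr C Y Z \<cdot>\<^bsub>C\<^esub> f = zero_arr C X Z"
proof -
  interpret abelian_group "hom_mod C Y Z" using hom_abelian_group assms by blast
  show ?thesis
    using zero_arr_unique[of X Z] cmp_closed[of X Y Z]
      cmp_add_left[of X Y Z f "zero_arr C Y Z" "zero_arr C Y Z"] assms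
    by force
qed

text \<open>If \<open>f\<close> were zero, composing it with its inverse would make
  \<open>ident C Y\<close> zero. This is what makes \<open>beta\<close> a legitimate step of a
  path.\<close>

lemma is_isom_nonzero:
  assumes "X \<in> Obj C" "Y \<in> Obj C" "is_isom C X Y f" "\<not> zero_object C Y"
  shows "f \<noteq> zero_arr C X Y"
  using assms cmp_zero_left[of Y X Y] unfolding is_isom_def zero_object_def by auto

lemma indecomposable_Obj: "indecomposable C E \<Longrightarrow> E \<in> Obj C"
  by (simp add: indecomposable_def)

text \<open>A biproduct sees only indices below \<open>n\<close>, while its families are total
  functions. This permits passing between families that agree in range, such as those read off a
  list and off a mapped list.\<close>

lemma biproduct_cong:
  assumes "biproduct C A n E i p"
    and "\<And>k. k < n \<Longrightarrow> E' k = E k" "\<And>k. k < n \<Longrightarrow> i' k = i k" "\<And>k. k < n \<Longrightarrow> p' k = p k"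
  shows "biproduct C A n E' i' p'"
proof -
  have "A \<in> Obj C" using assms(1) by (simp add: biproduct_def)
  then interpret abelian_group "hom_mod C A A" using hom_abelian_group by blast
  have "finsum (hom_mod C A A) (\<lambda>k. i' k \<cdot>\<^bsub>C\<^esub> p' k) {..<n} =
        finsum (hom_mod C A A) (\<lambda>k. i k \<cdot>\<^bsub>C\<^esub> p k) {..<n}"
    using assms cmp_closed by (intro finsum_cong') (auto simp: biproduct_def)
  then show ?thesis using assms by (simp add: biproduct_def)
qed

lemma decomposed_Obj: "decomposed C X \<Longrightarrow> tot X \<in> Obj C"
  by (simp add: decomposed_def biproduct_def)

lemma decomposed_summand:
  "decomposed C X \<Longrightarrow> i < length (parts X) \<Longrightarrow> indecomposable C (summand X i)"
  by (simp add: decomposed_def)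

lemma component_closed:
  assumes "decomposed C X" "decomposed C Y" "f \<in> arr C (tot X) (tot Y)"
    "i < length (parts X)" "j < length (parts Y)"
  shows "component C X Y f i j \<in> arr C (summand X i) (summand Y j)"
  using assms cmp_closed unfolding decomposed_def biproduct_def component_def by meson

lemma component_ident:
  assumes "decomposed C X" "i < length (parts X)" "j < length (parts X)"
  shows "component C X X (ident C (tot X)) i j =
    (if i = j then ident C (summand X i) else zero_arr C (summand X i) (summand X j))"
  using assms cmp_ident_left[of "summand X i" "tot X" "inc X i"]
  unfolding decomposed_def biproduct_def component_def by simp

end

section \<open>Linear functors preserve zero morphisms, finite sums and biproducts\<close>

lemma linear_functor_zero:
  assumes "linear_category K C" "linear_category K D" "linear_functor K C D F"
    and "X \<in> Obj C" "Y \<in> Obj C"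
  shows "onM F (zero_arr C X Y) = zero_arr D (onO F X) (onO F Y)"
proof -
  interpret C: linear_category K C by fact
  interpret D: linear_category K D by fact
  interpret A: abelian_group "hom_mod C X Y" using C.hom_abelian_group assms by blast
  have "onM F (zero_arr C X Y \<oplus>\<^bsub>hom_mod C X Y\<^esub> zero_arr C X Y) =
      onM F (zero_arr C X Y) \<oplus>\<^bsub>hom_mod D (onO F X) (onO F Y)\<^esub> onM F (zero_arr C X Y)"
    using assms(3-) A.zero_closed unfolding linear_functor_def by blast
  then show ?thesis
    using assms(3-) A.zero_closed unfolding linear_functor_def
    by (intro D.zero_arr_unique) auto
qed

lemma linear_functor_finsum:
  assumes "linear_category K C" "linear_category K D" "linear_functor K C D F"
    and XY: "X \<in> Obj C" "Y \<in> Obj C" and "finite A" "\<And>a. a \<in> A \<Longrightarrow> f a \<in> arr C X Y"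
  shows "onM F (finsum (hom_mod C X Y) f A) =
    finsum (hom_mod D (onO F X) (onO F Y)) (\<lambda>a. onM F (f a)) A"
proof -
  interpret C: linear_category K C by fact
  interpret D: linear_category K D by fact
  interpret A: abelian_group "hom_mod C X Y" using C.hom_abelian_group assms by blast
  have FXY: "onO F X \<in> Obj D" "onO F Y \<in> Obj D"
    using assms(3) XY unfolding linear_functor_def by auto
  then interpret B: abelian_group "hom_mod D (onO F X) (onO F Y)" by (rule D.hom_abelian_group)
  have FM: "onM F g \<in> arr D (onO F X) (onO F Y)" if "g \<in> arr C X Y" for g
    using assms(3) XY that unfolding linear_functor_def by blast
  show ?thesis
    using assms(6,7)
  proof (induction A rule: finite_induct)
    case empty
    then show ?case using linear_functor_zero[OF assms(1-5)] by simp
  next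
    case (insert a A)
    have "onM F (f a \<oplus>\<^bsub>hom_mod C X Y\<^esub> finsum (hom_mod C X Y) f A) =
        onM F (f a) \<oplus>\<^bsub>hom_mod D (onO F X) (onO F Y)\<^esub> onM F (finsum (hom_mod C X Y) f A)"
      using assms(3) XY insert.prems A.finsum_closed[of f A]
      unfolding linear_functor_def by (simp add: Pi_iff)
    then show ?case
      using insert FM by (simp add: Pi_iff)
  qed
qed

text \<open>A biproduct is given by equations between composites and sums of its inclusions and
  projections, and a linear functor preserves all of them.\<close>

lemma linear_functor_biproduct:
  assumes C: "linear_category K C" and D: "linear_category K D" and F: "linear_functor K C D F"
    and bi: "biproduct C A n E i p"
  shows "biproduct D (onO F A) n (\<lambda>k. onO F (E k)) (\<lambda>k. onM F (i k)) (\<lambda>k. onM F (p k))"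
proof -
  interpret C: linear_category K C by fact
  interpret D: linear_category K D by fact
  have A: "A \<in> Obj C" using bi by (simp add: biproduct_def)
  have E: "E k \<in> Obj C" "i k \<in> arr C (E k) A" "p k \<in> arr C A (E k)" if "k < n" for k
    using bi that by (auto simp: biproduct_def)
  have FM: "onM F f \<in> arr D (onO F X) (onO F Y)"
    if "X \<in> Obj C" "Y \<in> Obj C" "f \<in> arr C X Y" for X Y f
    using F that unfolding linear_functor_def by blast
  have Fcmp: "onM F (g \<cdot>\<^bsub>C\<^esub> f) = onM F g \<cdot>\<^bsub>D\<^esub> onM F f"
    if "X \<in> Obj C" "Y \<in> Obj C" "Z \<in> Obj C" "f \<in> arr C X Y" "g \<in> arr C Y Z" for X Y Z f g
    using F that unfolding linear_functor_def by blast
  have Fid: "onO F X \<in> Obj D" "onM F (ident C X) = ident D (onO F X)" if "X \<in> Obj C" for X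
    using F that unfolding linear_functor_def by auto
  interpret B: abelian_group "hom_mod D (onO F A) (onO F A)"
    using D.hom_abelian_group Fid(1)[OF A] by blast
  have "onM F (finsum (hom_mod C A A) (\<lambda>k. i k \<cdot>\<^bsub>C\<^esub> p k) {..<n}) =
      finsum (hom_mod D (onO F A) (onO F A)) (\<lambda>k. onM F (i k \<cdot>\<^bsub>C\<^esub> p k)) {..<n}"
    using E A by (intro linear_functor_finsum[OF C D F]) (auto intro: C.cmp_closed[of A "E _" A])
  also have "\<dots> = finsum (hom_mod D (onO F A) (onO F A)) (\<lambda>k. onM F (i k) \<cdot>\<^bsub>D\<^esub> onM F (p k)) {..<n}"
  proof (intro B.finsum_cong' Pi_I refl)
    fix k assume "k \<in> {..<n}"
    then have k: "E k \<in> Obj C" "i k \<in> arr C (E k) A" "p k \<in> arr C A (E k)" using E by auto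
    show "onM F (i k \<cdot>\<^bsub>C\<^esub> p k) = onM F (i k) \<cdot>\<^bsub>D\<^esub> onM F (p k)"
      using Fcmp[OF A k(1) A k(3,2)] .
    show "onM F (i k) \<cdot>\<^bsub>D\<^esub> onM F (p k) \<in> arr D (onO F A) (onO F A)"
      using D.cmp_closed[OF _ _ _ FM FM] k A Fid(1) by blast
  qed
  finally have "finsum (hom_mod D (onO F A) (onO F A)) (\<lambda>k. onM F (i k) \<cdot>\<^bsub>D\<^esub> onM F (p k)) {..<n}
      = ident D (onO F A)"
    using bi Fid(2)[OF A] by (simp add: biproduct_def)
  moreover have "onM F (p l) \<cdot>\<^bsub>D\<^esub> onM F (i k) =
      (if k = l then ident D (onO F (E k)) else zero_arr D (onO F (E k)) (onO F (E l)))"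
    if "k < n" "l < n" for k l
  proof -
    have "onM F (p l) \<cdot>\<^bsub>D\<^esub> onM F (i k) = onM F (p l \<cdot>\<^bsub>C\<^esub> i k)"
      using Fcmp[of "E k" A "E l"] E that A by simp
    also have "\<dots> = onM F (if k = l then ident C (E k) else zero_arr C (E k) (E l))"
      using bi that by (simp add: biproduct_def)
    finally show ?thesis
      using Fid(2) linear_functor_zero[OF C D F] E that by simp
  qed
  ultimately show ?thesis
    using E FM A Fid(1) by (simp add: biproduct_def)
qed

section \<open>The shift\<close>

context triangulated_category
begin

lemma shift_Obj: "X \<in> Obj C \<Longrightarrow> shO C n X \<in> Obj C"
  using shift_linear[of n] by (simp add: linear_functor_def shift_functor_def)

lemma shift_ident: "X \<in> Obj C \<Longrightarrow> shM C n (ident C X) = ident C (shO C n X)"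
  using shift_linear[of n] by (simp add: linear_functor_def shift_functor_def)

lemma shift_arr:
  "X \<in> Obj C \<Longrightarrow> Y \<in> Obj C \<Longrightarrow> f \<in> arr C X Y \<Longrightarrow> shM C n f \<in> arr C (shO C n X) (shO C n Y)"
  using shift_linear[of n] by (simp add: linear_functor_def shift_functor_def)

lemma shift_zero_arr:
  "X \<in> Obj C \<Longrightarrow> Y \<in> Obj C \<Longrightarrow> shM C n (zero_arr C X Y) = zero_arr C (shO C n X) (shO C n Y)"
  using linear_functor_zero[OF linear_category_axioms linear_category_axioms shift_linear, of X Y n]
  by (simp add: shift_functor_def)

lemma shift_shift_Obj: "X \<in> Obj C \<Longrightarrow> shO C m (shO C n X) = shO C (m + n) X"
  using shift_add[of m n] by (simp add: functor_eq_on_def shift_functor_def comp_functor_def)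

lemma shift_shift_arr:
  "X \<in> Obj C \<Longrightarrow> Y \<in> Obj C \<Longrightarrow> f \<in> arr C X Y \<Longrightarrow> shM C m (shM C n f) = shM C (m + n) f"
  using shift_add[of m n] by (auto simp: functor_eq_on_def shift_functor_def comp_functor_def)

lemma shift_zero_Obj: "X \<in> Obj C \<Longrightarrow> shO C 0 X = X"
  using shift_zero by (simp add: functor_eq_on_def shift_functor_def id_functor_def)

lemma shift_zero_mor: "X \<in> Obj C \<Longrightarrow> Y \<in> Obj C \<Longrightarrow> f \<in> arr C X Y \<Longrightarrow> shM C 0 f = f"
  using shift_zero by (auto simp: functor_eq_on_def shift_functor_def id_functor_def)

text \<open>\<open>[n]\<close> and \<open>[-n]\<close> are mutually inverse on the nose, so
  \<open>[n]\<close> kills no nonzero morphism.\<close>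

lemma shift_nonzero:
  assumes "X \<in> Obj C" "Y \<in> Obj C" "f \<in> arr C X Y" "f \<noteq> zero_arr C X Y"
  shows "shM C n f \<noteq> zero_arr C (shO C n X) (shO C n Y)"
proof
  assume "shM C n f = zero_arr C (shO C n X) (shO C n Y)"
  then have "shM C (- n) (shM C n f) = zero_arr C X Y"
    using assms by (simp add: shift_zero_arr shift_Obj shift_shift_Obj shift_zero_Obj)
  then show False
    using assms by (simp add: shift_shift_arr shift_zero_mor)
qed

lemma shift_biproduct:
  "biproduct C A n E i p \<Longrightarrow>
    biproduct C (shO C m A) n (\<lambda>k. shO C m (E k)) (\<lambda>k. shM C m (i k)) (\<lambda>k. shM C m (p k))"
  using linear_functor_biproduct[OF linear_category_axioms linear_category_axioms shift_linear[of m]]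
  by (simp add: shift_functor_def)

lemma shift_direct_sum:
  assumes "direct_sum_of C A Es"
  shows "direct_sum_of C (shO C m A) (map (shO C m) Es)"
proof -
  obtain i p where "biproduct C A (length Es) ((!) Es) i p"
    using assms by (auto simp: direct_sum_of_def)
  from biproduct_cong[OF shift_biproduct[OF this, of m], of "(!) (map (shO C m) Es)", OF _ refl refl]
  show ?thesis by (auto simp: direct_sum_of_def)
qed

lemma shift_zero_object:
  assumes "zero_object C X"
  shows "zero_object C (shO C n X)"
proof -
  have X: "X \<in> Obj C" "ident C X = zero_arr C X X" using assms by (auto simp: zero_object_def)
  then have "ident C (shO C n X) = zero_arr C (shO C n X) (shO C n X)"
    using shift_ident[of X n] shift_zero_arr[of X X n] by simp
  then show ?thesis using X by (simp add: zero_object_def shift_Obj)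
qed

lemma zero_object_shift_iff:
  assumes "X \<in> Obj C"
  shows "zero_object C (shO C n X) \<longleftrightarrow> zero_object C X"
  using shift_zero_object[of X n] shift_zero_object[of "shO C n X" "- n"] assms
  by (auto simp: shift_shift_Obj shift_zero_Obj)

lemma direct_sum_summands: "direct_sum_of C A Es \<Longrightarrow> set Es \<subseteq> Obj C"
  by (auto simp: direct_sum_of_def biproduct_def in_set_conv_nth)

text \<open>A splitting of \<open>E[n]\<close> is carried by \<open>[-n]\<close> to a splitting of
  \<open>E\<close>, and shifting does not affect whether a summand vanishes.\<close>

lemma shift_indecomposable:
  assumes E: "indecomposable C E"
  shows "indecomposable C (shO C n E)"
proof -
  have EO: "E \<in> Obj C" using E by (simp add: indecomposable_def)
  have "zero_object C X \<or> zero_object C Y" if sum: "direct_sum_of C (shO C n E) [X, Y]" for X Y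
  proof -
    have "direct_sum_of C E [shO C (- n) X, shO C (- n) Y]"
      using shift_direct_sum[OF sum, of "- n"] EO by (simp add: shift_shift_Obj shift_zero_Obj)
    then have "zero_object C (shO C (- n) X) \<or> zero_object C (shO C (- n) Y)"
      using E by (simp add: indecomposable_def)
    then show ?thesis using zero_object_shift_iff direct_sum_summands[OF sum] by auto
  qed
  then show ?thesis
    using E EO by (simp add: indecomposable_def shift_Obj zero_object_shift_iff)
qed

lemma shift_decomposed:
  assumes "decomposed C X"
  shows "decomposed C (shD C n X)"
proof -
  \<comment> \<open>The accessors of a shifted object are the shifted accessors at valid indices
    only, hence \<open>biproduct_cong\<close> below.\<close>
  have nth: "summand (shD C n X) k = shO C n (summand X k)" "inc (shD C n X) k = shM C n (inc X k)"
    "prj (shD C n X) k = shM C n (prj X k)" if "k < length (parts X)" for k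
    using that by (auto simp: shD_def summand_def inc_def prj_def split: prod.splits)
  have "biproduct C (shO C n (tot X)) (length (parts X))
      (summand (shD C n X)) (inc (shD C n X)) (prj (shD C n X))"
    using assms nth by (intro biproduct_cong[OF shift_biproduct]) (auto simp: decomposed_def)
  moreover have "tot (shD C n X) = shO C n (tot X)" "length (parts (shD C n X)) = length (parts X)"
    by (simp_all add: shD_def)
  ultimately show ?thesis
    using assms by (simp add: decomposed_def nth shift_indecomposable)
qed

end

section \<open>Real decompositions\<close>

context cyclic_category
begin

lemma real_decompositionD:
  assumes "real_decomposition K C G"
  shows "indecomposable C E \<Longrightarrow> indecomposable C F \<Longrightarrow> submodule (G E F a) K (hom_mod C E F)"
    and "indecomposable C E \<Longrightarrow> indecomposable C F \<Longrightarrow> f \<in> arr C E F \<Longrightarrow>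
      \<exists>!d. (\<forall>a. d a \<in> G E F a) \<and> finite {a. d a \<noteq> zero_arr C E F} \<and>
        finsum (hom_mod C E F) d {a. d a \<noteq> zero_arr C E F} = f"
    and "indecomposable C E \<Longrightarrow> indecomposable C F \<Longrightarrow> f \<in> G E F a \<Longrightarrow>
      shM C 1 f \<in> G (shO C 1 E) (shO C 1 F) a"
    and "indecomposable C E \<Longrightarrow> ident C E \<in> G E E 0"
    and "indecomposable C E \<Longrightarrow> beta C E \<in> G (shO C 2 E) E 0"
proof -
  note D = assms[unfolded real_decomposition_def]
  note D1 = D[THEN conjunct1] and D' = D[THEN conjunct2]
  note D2 = D'[THEN conjunct1] and D'' = D'[THEN conjunct2]
  note D3 = D''[THEN conjunct1]
  note D5 = D''[THEN conjunct2, THEN conjunct2, THEN conjunct1]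
  show "indecomposable C E \<Longrightarrow> indecomposable C F \<Longrightarrow> submodule (G E F a) K (hom_mod C E F)"
    using D1[rule_format] by blast
  show "indecomposable C E \<Longrightarrow> indecomposable C F \<Longrightarrow> f \<in> arr C E F \<Longrightarrow>
      \<exists>!d. (\<forall>a. d a \<in> G E F a) \<and> finite {a. d a \<noteq> zero_arr C E F} \<and>
        finsum (hom_mod C E F) d {a. d a \<noteq> zero_arr C E F} = f"
    by (rule D2[rule_format, OF conjI])
  show "indecomposable C E \<Longrightarrow> indecomposable C F \<Longrightarrow> f \<in> G E F a \<Longrightarrow>
      shM C 1 f \<in> G (shO C 1 E) (shO C 1 F) a"
    using D3[rule_format] by blast
  show "indecomposable C E \<Longrightarrow> ident C E \<in> G E E 0" "indecomposable C E \<Longrightarrow> beta C E \<in> G (shO C 2 E) E 0"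
    using D5[rule_format] by blast+
qed

lemma grading_submodule:
  assumes "real_decomposition K C G" "indecomposable C E" "indecomposable C F"
  shows "G E F a \<subseteq> arr C E F" "zero_arr C E F \<in> G E F a"
proof -
  have "submodule (G E F a) K (hom_mod C E F)"
    using real_decompositionD(1) assms .
  then have "subgroup (G E F a) (add_monoid (hom_mod C E F))"
    by (simp add: submodule_def)
  then show "G E F a \<subseteq> arr C E F" "zero_arr C E F \<in> G E F a"
    using subgroup.subset subgroup.one_closed by force+
qed

text \<open>Every graded piece is a submodule, so zero is homogeneous of all degrees at once;
  gradings have to be compared on nonzero morphisms only.\<close>

lemma homogeneous_zero:
  "real_decomposition K C G \<Longrightarrow> indecomposable C E \<Longrightarrow> indecomposable C F \<Longrightarrow>
    homogeneous G E F (zero_arr C E F)"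
  using grading_submodule(2) unfolding homogeneous_def by blast

lemma homogeneous_arr:
  "real_decomposition K C G \<Longrightarrow> indecomposable C E \<Longrightarrow> indecomposable C F \<Longrightarrow>
    homogeneous G E F f \<Longrightarrow> f \<in> arr C E F"
  using grading_submodule(1) unfolding homogeneous_def by blast

text \<open>A morphism in two graded pieces has two homogeneous decompositions, one concentrated in
  degree \<open>a\<close>, the other in degree \<open>b\<close>; uniqueness of decompositions
  identifies them.\<close>

lemma degree_unique:
  assumes G: "real_decomposition K C G" and E: "indecomposable C E" and F: "indecomposable C F"
    and f: "f \<in> G E F a" "f \<in> G E F b" "f \<noteq> zero_arr C E F"
  shows "a = b"
proof -
  have EF: "E \<in> Obj C" "F \<in> Obj C" using E F by (simp_all add: indecomposable_def)
  interpret abelian_group "hom_mod C E F" using hom_abelian_group[OF EF] .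
  have fa: "f \<in> arr C E F" using grading_submodule[OF G E F] f by blast
  define d where "d = (\<lambda>(c::real) (x::real). if x = c then f else zero_arr C E F)"
  \<comment> \<open>As \<open>f\<close> is nonzero, the support is exactly \<open>{c}\<close>, and
    the sum over it is \<open>f\<close>.\<close>
  have supp: "{x. d c x \<noteq> zero_arr C E F} = {c}" for c :: real
    using f by (auto simp: d_def)
  have "finsum (hom_mod C E F) (d c) {c} = f" for c :: real
    using fa finsum_insert[of "{}" c "d c"] by (simp add: d_def)
  moreover have "d c x \<in> G E F x" if "f \<in> G E F c" for c x
    using that grading_submodule(2)[OF G E F] by (simp add: d_def)
  ultimately have "(\<forall>x. d c x \<in> G E F x) \<and> finite {x. d c x \<noteq> zero_arr C E F} \<and>
      finsum (hom_mod C E F) (d c) {x. d c x \<noteq> zero_arr C E F} = f" if "f \<in> G E F c" for c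
    using that by (simp add: supp)
  moreover have "\<exists>!d. (\<forall>a. d a \<in> G E F a) \<and> finite {a. d a \<noteq> zero_arr C E F} \<and>
      finsum (hom_mod C E F) d {a. d a \<noteq> zero_arr C E F} = f"
    using real_decompositionD(2)[OF G E F fa] .
  ultimately have "d a = d b" using f by blast
  \<comment> \<open>In degree \<open>a\<close> the first family has the value \<open>f\<close>; the
    second is zero there unless \<open>a = b\<close>.\<close>
  then have "d a a = d b a" by simp
  then show ?thesis using f(3) by (simp add: d_def split: if_splits)
qed

lemma deg_eq:
  assumes "real_decomposition K C G" "indecomposable C E" "indecomposable C F"
    and "f \<in> G E F a" "f \<noteq> zero_arr C E F"
  shows "deg G E F f = a"
  unfolding deg_def using assms degree_unique by blast

text \<open>Expresses graded pieces through homogeneity and \<open>deg\<close>, the two data that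
  deformation equivalence compares. For nonzero homogeneous \<open>f\<close> the description
  defining \<open>deg\<close> is unique.\<close>

lemma in_grading_iff:
  assumes "real_decomposition K C G" "indecomposable C E" "indecomposable C F" "f \<noteq> zero_arr C E F"
  shows "f \<in> G E F a \<longleftrightarrow> homogeneous G E F f \<and> deg G E F f = a"
  using assms deg_eq unfolding homogeneous_def by blast

end

section \<open>Degrees and homogeneity of concatenated and shifted paths\<close>

lemma path_deg_Nil [simp]: "path_deg G [] = 0"
  by (simp add: path_deg_def)

lemma path_deg_Cons [simp]:
  "path_deg G ((A, B, s, f) # l) = (if s then deg G A B f else - deg G B A f) + path_deg G l"
  by (simp add: path_deg_def)

lemma path_deg_append [simp]: "path_deg G (l @ l') = path_deg G l + path_deg G l'"
  by (simp add: path_deg_def)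

lemma homogeneous_path_Nil [simp]: "homogeneous_path G []"
  by (simp add: homogeneous_path_def)

lemma homogeneous_path_Cons [simp]:
  "homogeneous_path G ((A, B, s, f) # l) \<longleftrightarrow>
    (if s then homogeneous G A B f else homogeneous G B A f) \<and> homogeneous_path G l"
  by (auto simp: homogeneous_path_def)

lemma homogeneous_path_append [simp]:
  "homogeneous_path G (l @ l') \<longleftrightarrow> homogeneous_path G l \<and> homogeneous_path G l'"
  by (simp add: homogeneous_path_def ball_Un)

lemma zigzag_ends: "zigzag C E l F \<Longrightarrow> indecomposable C E \<and> indecomposable C F"
  by (induction C E l F rule: zigzag.induct) auto

lemma zigzag_append: "zigzag C E l F \<Longrightarrow> zigzag C F l' H \<Longrightarrow> zigzag C E (l @ l') H"
  by (induction C E l F rule: zigzag.induct) auto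

context triangulated_category
begin

lemma shift_path_zigzag:
  "zigzag C E l F \<Longrightarrow> zigzag C (shO C 1 E) (shift_path C l) (shO C 1 F)"
proof (induction l arbitrary: E)
  case Nil
  then show ?case using shift_indecomposable by (auto simp: shift_path_def)
next
  case (Cons x l)
  obtain A B s f where "x = (A, B, s, f)" by (cases x)
  with Cons show ?case
    by (auto simp: shift_path_def shift_indecomposable shift_arr shift_nonzero indecomposable_Obj)
qed

end

context cyclic_category
begin

text \<open>A real decomposition puts \<open>f[1]\<close> in the piece of the same degree as
  \<open>f\<close>, and \<open>f[1]\<close> stays nonzero, so this degree is its only one.\<close>

lemma shift_homogeneous:
  assumes G: "real_decomposition K C G" and E: "indecomposable C E" and F: "indecomposable C F"
    and f: "homogeneous G E F f" "f \<noteq> zero_arr C E F"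
  shows "homogeneous G (shO C 1 E) (shO C 1 F) (shM C 1 f)"
    and "deg G (shO C 1 E) (shO C 1 F) (shM C 1 f) = deg G E F f"
proof -
  have fG: "f \<in> G E F (deg G E F f)"
    using in_grading_iff[OF G E F f(2)] f(1) by simp
  then have shG: "shM C 1 f \<in> G (shO C 1 E) (shO C 1 F) (deg G E F f)"
    using real_decompositionD(3)[OF G E F] by blast
  then show "homogeneous G (shO C 1 E) (shO C 1 F) (shM C 1 f)"
    unfolding homogeneous_def by blast
  have "f \<in> arr C E F" using fG grading_submodule[OF G E F] by blast
  then have "shM C 1 f \<noteq> zero_arr C (shO C 1 E) (shO C 1 F)"
    using f(2) E F shift_nonzero indecomposable_Obj by blast
  then show "deg G (shO C 1 E) (shO C 1 F) (shM C 1 f) = deg G E F f"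
    using deg_eq[OF G] shG E F shift_indecomposable by blast
qed

lemma shift_path_homogeneous:
  assumes G: "real_decomposition K C G"
  shows "zigzag C E l F \<Longrightarrow> homogeneous_path G l \<Longrightarrow>
    homogeneous_path G (shift_path C l) \<and> path_deg G (shift_path C l) = path_deg G l"
proof (induction l arbitrary: E)
  case Nil
  then show ?case by (simp add: shift_path_def)
next
  case (Cons x l)
  obtain A B s f where x: "x = (A, B, s, f)" by (cases x)
  have "homogeneous_path G (shift_path C l) \<and> path_deg G (shift_path C l) = path_deg G l"
    using Cons x by auto
  moreover have "shift_path C (x # l) = (shO C 1 A, shO C 1 B, s, shM C 1 f) # shift_path C l"
    by (simp add: x shift_path_def)
  ultimately show ?case
    using Cons.prems shift_homogeneous[OF G, of A B f] shift_homogeneous[OF G, of B A f]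
    by (auto simp: x split: if_splits)
qed

lemma beta_arr: "E \<in> Obj C \<Longrightarrow> is_isom C (shO C 2 E) E (beta C E)"
  using beta_iso by (simp add: natural_iso_def shift_functor_def id_functor_def)

lemma beta_zigzag:
  assumes E: "indecomposable C E"
  shows "zigzag C (shO C 2 E) [(shO C 2 E, E, True, beta C E)] E"
proof -
  have EO: "E \<in> Obj C" and nz: "\<not> zero_object C E" using E by (simp_all add: indecomposable_def)
  show ?thesis
    using E is_isom_nonzero[OF shift_Obj[OF EO] EO beta_arr[OF EO] nz] beta_arr[OF EO]
    by (simp add: shift_indecomposable is_isom_def)
qed

lemma beta_degree:
  assumes "real_decomposition K C G" "indecomposable C E"
  shows "homogeneous G (shO C 2 E) E (beta C E)" "deg G (shO C 2 E) E (beta C E) = 0"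
proof -
  have "beta C E \<in> G (shO C 2 E) E 0" using real_decompositionD(5)[OF assms] .
  moreover have "beta C E \<noteq> zero_arr C (shO C 2 E) E" using beta_zigzag[OF assms(2)] by simp
  ultimately show "homogeneous G (shO C 2 E) E (beta C E)" "deg G (shO C 2 E) E (beta C E) = 0"
    using in_grading_iff[OF assms(1) shift_indecomposable assms(2)] assms(2) by blast+
qed

end

section \<open>Paths in diagrams\<close>

context linear_category
begin

text \<open>Forgets the positions in the diagram, so that deformation equivalence, which speaks of
  zigzags in \<open>C\<close>, applies to paths in diagrams.\<close>

lemma path_in_zigzag:
  assumes wf: "wf_diagram C D"
  shows "path_in C D x l y \<Longrightarrow>
    zigzag C (summand (obj_at D (fst x)) (snd x)) l (summand (obj_at D (fst y)) (snd y))"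
proof (induction rule: path_in.induct)
  case (path_in_nil v i)
  then show ?case using wf by (simp add: wf_diagram_def decomposed_def)
next
  case (path_in_forward v w X Y i j f l y)
  have "v \<in> verts D" "w \<in> verts D" using path_in_forward.hyps(1) wf by (auto simp: wf_diagram_def)
  then have XY: "decomposed C X" "decomposed C Y"
    using path_in_forward.hyps(2,3) wf by (simp_all add: wf_diagram_def)
  have "mor_at D (v, w) \<in> arr C (tot X) (tot Y)"
    using path_in_forward.hyps(1-3) wf by (auto simp: wf_diagram_def)
  then have "f \<in> arr C (summand X i) (summand Y j)"
    using component_closed[of X Y] XY path_in_forward.hyps(4-6) by simp
  then show ?case
    using path_in_forward.IH path_in_forward.hyps(2-5,7)
      decomposed_summand[OF XY(1)] decomposed_summand[OF XY(2)]
    by simp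
next
  case (path_in_backward w v X Y i j f l y)
  have "v \<in> verts D" "w \<in> verts D"
    using path_in_backward.hyps(1) wf by (auto simp: wf_diagram_def)
  then have XY: "decomposed C X" "decomposed C Y"
    using path_in_backward.hyps(2,3) wf by (simp_all add: wf_diagram_def)
  have "mor_at D (w, v) \<in> arr C (tot Y) (tot X)"
    using path_in_backward.hyps(1-3) wf by (auto simp: wf_diagram_def)
  then have "f \<in> arr C (summand Y j) (summand X i)"
    using component_closed[of Y X] XY path_in_backward.hyps(4-6) by simp
  then show ?case
    using path_in_backward.IH path_in_backward.hyps(2-5,7)
      decomposed_summand[OF XY(1)] decomposed_summand[OF XY(2)]
    by simp
qed

end

lemma path_in_homogeneous:
  assumes "\<forall>(v, w)\<in>edges D. quasi_homogeneous C G (obj_at D v) (obj_at D w) (mor_at D (v, w))"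
  shows "path_in C D x l y \<Longrightarrow> homogeneous_path G l"
proof (induction rule: path_in.induct)
  case (path_in_nil v i)
  then show ?case by simp
next
  case (path_in_forward v w X Y i j f l y)
  then have "quasi_homogeneous C G X Y (mor_at D (v, w))" using assms by blast
  then show ?case using path_in_forward by (simp add: quasi_homogeneous_def)
next
  case (path_in_backward w v X Y i j f l y)
  then have "quasi_homogeneous C G Y X (mor_at D (w, v))" using assms by blast
  then show ?case using path_in_backward by (simp add: quasi_homogeneous_def)
qed

text \<open>A single edge together with its two distinct ends is a tree, so local liftability
  applies to it.\<close>

lemma locally_liftable_edge:
  assumes D: "locally_liftable_diagram C G D" and e: "(v, w) \<in> edges D"
  shows "quasi_homogeneous C G (obj_at D v) (obj_at D w) (mor_at D (v, w))"
proof -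
  have wf: "wf_diagram C D"
    using D by (simp add: locally_liftable_diagram_def commutative_def)
  have vw: "v \<in> verts D" "w \<in> verts D" "v \<noteq> w"
    using wf e by (auto simp: wf_diagram_def irrefl_def)
  \<comment> \<open>Removing the edge leaves the empty relation, whose closure does not relate the
    distinct \<open>v\<close> and \<open>w\<close>: the edge is a bridge.\<close>
  have "simply_connected_graph {v, w} {(v, w)}"
    using vw(3) unfolding simply_connected_graph_def by auto
  then have "liftable_diagram C G (D\<lparr>verts := {v, w}, edges := {(v, w)}\<rparr>)"
    using D[unfolded locally_liftable_diagram_def, THEN conjunct2, rule_format, of "{v, w}" "{(v, w)}"]
      e vw by simp
  then show ?thesis by (simp add: liftable_diagram_def)
qed

section \<open>Deformation invariance of liftability\<close>

locale deformation = cyclic_category K C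
  for K :: "('k, 'r) ring_scheme" and C :: "('o, 'm, 'k, 'c) cyccat_scheme" +
  fixes L :: "('l, 'x) monoid_scheme" and v :: "('o \<Rightarrow>\<^sub>0 int) set \<Rightarrow> 'l"
    and R R' :: "('o, 'm) charge_triple"
  assumes triple: "is_charge_triple K C L v R" "is_charge_triple K C L v R'"
    and deform: "deformation_equivalent C R R'"
begin

lemma real_decomp: "real_decomposition K C (gr R)" "real_decomposition K C (gr R')"
  using triple by (simp_all add: is_charge_triple_def)

text \<open>Deformation equivalence speaks of pairs of paths; here both members of the pair are
  \<open>l\<close>.\<close>

lemma homogeneous_path_iff:
  "zigzag C E l F \<Longrightarrow> homogeneous_path (gr R) l \<longleftrightarrow> homogeneous_path (gr R') l"
  using deform unfolding deformation_equivalent_def by blast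

lemma path_deg_diff:
  "zigzag C E l F \<Longrightarrow> zigzag C E l' F \<Longrightarrow> homogeneous_path (gr R) l \<Longrightarrow> homogeneous_path (gr R) l' \<Longrightarrow>
    path_deg (gr R) l - path_deg (gr R) l' = path_deg (gr R') l - path_deg (gr R') l'"
  using deform unfolding deformation_equivalent_def by blast

lemma loop_deg_eq:
  "zigzag C E l E \<Longrightarrow> homogeneous_path (gr R) l \<Longrightarrow> path_deg (gr R) l = path_deg (gr R') l"
  using path_deg_diff[of E l E "[]"] zigzag_ends by fastforce

lemma homogeneous_iff:
  assumes E: "indecomposable C E" and F: "indecomposable C F"
  shows "homogeneous (gr R) E F f \<longleftrightarrow> homogeneous (gr R') E F f"
\<comment> \<open>Steps of zigzags are nonzero by definition, so the zero morphism is treated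
  apart.\<close>
proof (cases "f = zero_arr C E F")
  case True
  then show ?thesis using homogeneous_zero real_decomp E F by blast
next
  case False
  have "homogeneous (gr R) E F f \<longleftrightarrow> homogeneous (gr R') E F f" if "f \<in> arr C E F"
    using homogeneous_path_iff[of E "[(E, F, True, f)]" F] that False E F by simp
  \<comment> \<open>Outside \<open>arr C E F\<close> nothing is homogeneous for either
    grading.\<close>
  then show ?thesis using homogeneous_arr real_decomp E F by blast
qed

lemma quasi_homogeneous_iff:
  "decomposed C X \<Longrightarrow> decomposed C Y \<Longrightarrow>
    quasi_homogeneous C (gr R) X Y f \<longleftrightarrow> quasi_homogeneous C (gr R') X Y f"
  by (simp add: quasi_homogeneous_def homogeneous_iff decomposed_summand)

lemma liftable_diagram_iff: "liftable_diagram C (gr R) D \<longleftrightarrow> liftable_diagram C (gr R') D"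
\<comment> \<open>Loop degrees can be compared only along homogeneous loops, which the first case
  guarantees. In the second case neither side holds, since liftability for \<open>R'\<close> would
  bring quasi-homogeneity back to \<open>R\<close>.\<close>
proof (cases "commutative C D \<and>
    (\<forall>(v, w)\<in>edges D. quasi_homogeneous C (gr R) (obj_at D v) (obj_at D w) (mor_at D (v, w)))")
  case True
  have wf: "wf_diagram C D" using True by (simp add: commutative_def)
  have "quasi_homogeneous C (gr R') (obj_at D v) (obj_at D w) (mor_at D (v, w))"
    if "(v, w) \<in> edges D" for v w
    using True that wf quasi_homogeneous_iff unfolding wf_diagram_def by blast
  moreover have "path_deg (gr R) l = path_deg (gr R') l" if "path_in C D x l x" for x l
    using loop_deg_eq path_in_zigzag[OF wf that] path_in_homogeneous[OF conjunct2[OF True] that]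
    by blast
  ultimately show ?thesis using True unfolding liftable_diagram_def by auto
next
  case False
  have "quasi_homogeneous C (gr R) (obj_at D v) (obj_at D w) (mor_at D (v, w))"
    if "(v, w) \<in> edges D" "liftable_diagram C (gr R') D" for v w
  proof -
    have "wf_diagram C D" using that(2) by (simp add: liftable_diagram_def commutative_def)
    then show ?thesis
      using that quasi_homogeneous_iff unfolding wf_diagram_def liftable_diagram_def by blast
  qed
  then show ?thesis using False unfolding liftable_diagram_def by blast
qed

text \<open>The grading enters \<open>pre_liftable\<close> only through
  \<open>liftable_diagram\<close>; the distinguished triangles are those of \<open>C\<close> in both
  cases.\<close>

lemma pre_liftable_iff: "pre_liftable C (gr R) \<longleftrightarrow> pre_liftable C (gr R')"
  by (simp only: pre_liftable_def liftable_diagram_iff)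

lemma fundamental_hexagon_iff:
  "fundamental_hexagon C (gr R) A B Z f g h \<longleftrightarrow> fundamental_hexagon C (gr R') A B Z f g h"
  by (simp only: fundamental_hexagon_def locally_liftable_diagram_def liftable_diagram_iff)

lemma basic_loop_iff: "basic_loop C (gr R) l p \<longleftrightarrow> basic_loop C (gr R') l p"
  by (simp only: basic_loop_def fundamental_hexagon_iff)

text \<open>Closing up \<open>p\<close> with \<open>p[1]\<close> and \<open>\<beta>\<close> gives a loop of degree \<open>2 q(p)\<close>.\<close>

lemma shift_path_deg_eq:
  assumes p: "zigzag C E p (shO C 1 E)" "homogeneous_path (gr R) p"
  shows "path_deg (gr R) p = path_deg (gr R') p"
proof -
  define l where "l = p @ shift_path C p @ [(shO C 2 E, E, True, beta C E)]"
  have E: "indecomposable C E" using zigzag_ends[OF p(1)] by simp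
  \<comment> \<open>Shifts compose strictly, so \<open>p[1]\<close> ends exactly at the source of
    \<open>beta C E\<close>.\<close>
  have sp: "zigzag C (shO C 1 E) (shift_path C p) (shO C 2 E)"
    using shift_path_zigzag[OF p(1)] E by (simp add: shift_shift_Obj indecomposable_Obj)
  then have l: "zigzag C E l E"
    unfolding l_def by (intro zigzag_append[OF p(1)] zigzag_append[OF sp] beta_zigzag[OF E])
  \<comment> \<open>\<open>p\<close> and \<open>p[1]\<close> have equal degrees and
    \<open>beta\<close> has degree 0.\<close>
  have "homogeneous_path G l \<and> path_deg G l = 2 * path_deg G p"
    if "real_decomposition K C G" "homogeneous_path G p" for G
    unfolding l_def using that beta_degree[OF that(1) E] shift_path_homogeneous[OF that(1) p(1)]
    by simp
  then have "homogeneous_path (gr R) l" "path_deg (gr R) l = 2 * path_deg (gr R) p"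
    "path_deg (gr R') l = 2 * path_deg (gr R') p"
    using real_decomp p homogeneous_path_iff by blast+
  then show ?thesis using loop_deg_eq[OF l] by simp
qed

text \<open>The triangle diagram is part of the hexagon: vertices 0 to 3 carry the same objects, and
  its edges are edges of the hexagon with the same morphisms. Typing and quasi-homogeneity are
  inherited.\<close>

lemma hexagon_path:
  assumes hex: "fundamental_hexagon C G A B Z f g h"
    and p: "path_in C (triangle_diagram C A B Z f g h) (0, i) p (3, i)"
  shows "zigzag C (summand A i) p (shO C 1 (summand A i))" "homogeneous_path G p"
proof -
  let ?H = "hexagon_diagram C A B Z f g h" and ?T = "triangle_diagram C A B Z f g h"
  have loc: "locally_liftable_diagram C G ?H"
    using hex by (simp add: fundamental_hexagon_def)
  then have wf: "wf_diagram C ?H" by (simp add: locally_liftable_diagram_def commutative_def)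
  have verts: "verts ?T = {0, 1, 2, 3}" "verts ?H = {0, 1, 2, 3, 4, 5}"
    by (auto simp: triangle_diagram_def hexagon_diagram_def mk_diagram_def)
  have edges: "edges ?T = {(0, 1), (1, 2), (2, 3)}"
    by (auto simp: triangle_diagram_def mk_diagram_def)
  have obj: "obj_at ?T w = obj_at ?H w" if "w \<in> {0, 1, 2, 3}" for w
    using that by (auto simp: triangle_diagram_def hexagon_diagram_def mk_diagram_def)
  have edge: "e \<in> edges ?H \<and> mor_at ?T e = mor_at ?H e" if "e \<in> edges ?T" for e
    using that unfolding edges
    by (auto simp: triangle_diagram_def hexagon_diagram_def mk_diagram_def)
  have vert: "u \<in> {0, 1, 2, 3}" "w \<in> {0, 1, 2, 3}" if "(u, w) \<in> edges ?T" for u w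
    using that unfolding edges by auto
  have wfT: "wf_diagram C ?T"
    unfolding wf_diagram_def
  proof (intro conjI ballI)
    show "edges ?T \<subseteq> verts ?T \<times> verts ?T" "irrefl (edges ?T)"
      unfolding edges verts by (auto simp: irrefl_def)
    show "decomposed C (obj_at ?T w)" if "w \<in> verts ?T" for w
      using that wf obj[of w] verts unfolding wf_diagram_def by auto
    show "case e of (u, w) \<Rightarrow> mor_at ?T (u, w) \<in> arr C (tot (obj_at ?T u)) (tot (obj_at ?T w))"
      if "e \<in> edges ?T" for e
      using that wf edge[of e] obj vert unfolding wf_diagram_def by (cases e) auto
  qed
  \<comment> \<open>Ensures that the \<open>i\<close>-th summand at vertex 3 is the shift of the
    \<open>i\<close>-th summand of \<open>A\<close>.\<close>
  have i: "i < length (parts A)"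
    using p by (cases rule: path_in.cases) (auto simp: triangle_diagram_def mk_diagram_def)
  have "\<forall>(u, w)\<in>edges ?T. quasi_homogeneous C G (obj_at ?T u) (obj_at ?T w) (mor_at ?T (u, w))"
    using locally_liftable_edge[OF loc] edge obj vert by auto
  then show "homogeneous_path G p" by (rule path_in_homogeneous[OF _ p])
  show "zigzag C (summand A i) p (shO C 1 (summand A i))"
    using path_in_zigzag[OF wfT p] i
    by (simp add: triangle_diagram_def mk_diagram_def shD_def summand_def split: prod.splits)
qed

lemma maslov_index_eq:
  assumes "basic_loop C (gr R) l p"
  shows "maslov_index (gr R) p = maslov_index (gr R') p"
proof -
  obtain A B Z f g h i where "fundamental_hexagon C (gr R) A B Z f g h"
    "path_in C (triangle_diagram C A B Z f g h) (0, i) p (3, i)"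
    using assms unfolding basic_loop_def by blast
  from hexagon_path[OF this] show ?thesis
    using shift_path_deg_eq by (simp add: maslov_index_def)
qed

lemma liftable_deformation:
  assumes "liftable C R"
  shows "liftable C R'"
  unfolding liftable_def
proof (intro conjI allI impI)
  show "pre_liftable C (gr R')"
    using assms pre_liftable_iff by (simp add: liftable_def)
  \<comment> \<open>A basic loop for \<open>R'\<close> is one for \<open>R\<close>, where its index
    vanishes by assumption.\<close>
  show "maslov_index (gr R') p = 0" if "basic_loop C (gr R') l p" for l p
    using that assms basic_loop_iff maslov_index_eq by (auto simp: liftable_def)
qed

end

section \<open>Potentials\<close>

text \<open>A potential records by how much the degrees of \<open>R'\<close> differ from those of \<open>R\<close>; the gradings of
  deformation equivalent charge triples differ by such a coboundary.\<close>

definition potential ::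
  "('o, 'm, 'k, 'c) tricat_scheme \<Rightarrow> ('o, 'm) charge_triple \<Rightarrow> ('o, 'm) charge_triple
    \<Rightarrow> ('o \<Rightarrow> real) \<Rightarrow> bool"
where
  "potential C R R' \<delta> \<longleftrightarrow>
     (\<forall>E F a. indecomposable C E \<and> indecomposable C F \<longrightarrow>
        gr R' E F (a + \<delta> F - \<delta> E) = gr R E F a) \<and>
     (\<forall>E. indecomposable C E \<longrightarrow>
        \<delta> (shO C 1 E) = \<delta> E \<and> [phase R' E = phase R E + \<delta> E] (rmod 2))"

text \<open>Supplies the quasi-inverse of the regrading functor.\<close>

lemma potential_sym:
  assumes "potential C R R' \<delta>"
  shows "potential C R' R (\<lambda>E. - \<delta> E)"
  unfolding potential_def
proof (intro conjI allI impI)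
  fix E F a assume "indecomposable C E \<and> indecomposable C F"
  \<comment> \<open>The defining identity, taken at the degree for which its left side becomes
    \<open>gr R' E F a\<close>.\<close>
  then have "gr R' E F ((a + - \<delta> F - - \<delta> E) + \<delta> F - \<delta> E) = gr R E F (a + - \<delta> F - - \<delta> E)"
    using assms unfolding potential_def by blast
  then show "gr R E F (a + - \<delta> F - - \<delta> E) = gr R' E F a" by simp
next
  fix E assume E: "indecomposable C E"
  then show "- \<delta> (shO C 1 E) = - \<delta> E" using assms by (simp add: potential_def)
  have "[phase R' E = phase R E + \<delta> E] (rmod 2)" using assms E by (simp add: potential_def)
  from rcong_diff[OF this rcong_refl[of "\<delta> E"]]
  show "[phase R E = phase R' E + - \<delta> E] (rmod 2)" by (simp add: rcong_sym)
qed

text \<open>The phase congruence for single homogeneous morphisms, summed along the path: the phase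
  differences telescope.\<close>

lemma (in cyclic_category) path_deg_phase:
  assumes R: "is_charge_triple K C L v R"
  shows "zigzag C E l F \<Longrightarrow> homogeneous_path (gr R) l \<Longrightarrow>
    [path_deg (gr R) l = phase R F - phase R E] (rmod 2)"
proof (induction l arbitrary: E)
  case Nil
  then show ?case by simp
next
  case (Cons x l)
  obtain A B s f where x: "x = (A, B, s, f)" by (cases x)
  have step: "[deg (gr R) A B f = phase R B - phase R A] (rmod 2)"
    if "indecomposable C A" "indecomposable C B" "f \<in> arr C A B" "f \<noteq> zero_arr C A B"
      "homogeneous (gr R) A B f" for A B f
    using R that unfolding is_charge_triple_def by blast
  have "[path_deg (gr R) l = phase R F - phase R B] (rmod 2)"
    using Cons x by auto
  moreover have "[if s then deg (gr R) A B f else - deg (gr R) B A f = phase R B - phase R A] (rmod 2)"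
  proof (cases s)
    case True
    then show ?thesis using step[of A B f] Cons.prems x by auto
  next
    case False
    then have "[deg (gr R) B A f = phase R A - phase R B] (rmod 2)"
      using step[of B A f] Cons.prems x by auto
    from rcong_uminus[OF this] show ?thesis using False by simp
  qed
  ultimately have "[path_deg (gr R) (x # l) =
      (phase R B - phase R A) + (phase R F - phase R B)] (rmod 2)"
    unfolding x path_deg_Cons by (rule rcong_add[rotated])
  moreover have "A = E" using Cons.prems x by simp
  ultimately show ?case by simp
qed

context deformation
begin

lemma exists_potential:
  assumes conn: "connective C (gr R)"
  shows "\<exists>\<delta>. potential C R R' \<delta>"
proof (cases "\<exists>E. indecomposable C E")
  \<comment> \<open>Without indecomposable objects every function is a potential.\<close>
  case False
  then show ?thesis by (simp add: potential_def)
next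
  case True
  then obtain E0 where E0: "indecomposable C E0" by blast
  \<comment> \<open>Any other choice of paths gives the same \<open>\<delta>\<close>, since the
    difference of the two degrees of a path depends only on its ends.\<close>
  define P where "P E = (SOME l. connecting_path C (gr R) E0 l E)" for E
  have P: "zigzag C E0 (P E) E" "homogeneous_path (gr R) (P E)" if "indecomposable C E" for E
  proof -
    have "\<exists>l. connecting_path C (gr R) E0 l E"
      using conn E0 that by (simp add: connective_def)
    from someI_ex[OF this] show "zigzag C E0 (P E) E" "homogeneous_path (gr R) (P E)"
      by (simp_all add: P_def connecting_path_def)
  qed
  \<comment> \<open>The constant makes \<open>\<delta>\<close> equal to the phase difference at
    \<open>E0\<close>; the congruence modulo 2 then propagates along \<open>P E\<close>.\<close>
  define \<delta> where "\<delta> E = phase R' E0 - phase R E0 + path_deg (gr R') (P E) - path_deg (gr R) (P E)"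
    for E
  have key: "path_deg (gr R') l - path_deg (gr R) l = \<delta> F - \<delta> E"
    if l: "zigzag C E l F" "homogeneous_path (gr R) l" for E l F
  proof -
    have EF: "indecomposable C E" "indecomposable C F" using zigzag_ends[OF l(1)] by simp_all
    \<comment> \<open>\<open>P E\<close> followed by \<open>l\<close> and the chosen path
      \<open>P F\<close> have the same ends, so their relative degree is the same for
      \<open>R\<close> and \<open>R'\<close>.\<close>
    show ?thesis
      using path_deg_diff[OF zigzag_append[OF P(1)[OF EF(1)] l(1)] P(1)[OF EF(2)]] l(2) P(2) EF
      by (simp add: \<delta>_def)
  qed
  have "gr R' E F (a + \<delta> F - \<delta> E) = gr R E F a"
    if EF: "indecomposable C E" "indecomposable C F" for E F a
  proof (rule Set.set_eqI)
    fix f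
    show "f \<in> gr R' E F (a + \<delta> F - \<delta> E) \<longleftrightarrow> f \<in> gr R E F a"
    \<comment> \<open>A nonzero homogeneous morphism is a path of length one, to which
      \<open>key\<close> applies. Otherwise \<open>f\<close> is zero and lies in both pieces, or is
      homogeneous for neither grading.\<close>
    proof (cases "f \<noteq> zero_arr C E F \<and> homogeneous (gr R) E F f")
      case True
      then have "deg (gr R') E F f - deg (gr R) E F f = \<delta> F - \<delta> E"
        using key[of E "[(E, F, True, f)]" F] homogeneous_arr[OF real_decomp(1) EF] EF by simp
      then show ?thesis
        using in_grading_iff[OF real_decomp(1) EF] in_grading_iff[OF real_decomp(2) EF]
          homogeneous_iff[OF EF] True by auto
    next
      case False
      then show ?thesis
        using in_grading_iff[OF real_decomp(1) EF] in_grading_iff[OF real_decomp(2) EF]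
          homogeneous_iff[OF EF] grading_submodule(2)[OF real_decomp(1) EF]
          grading_submodule(2)[OF real_decomp(2) EF] by metis
    qed
  qed
  moreover have "\<delta> (shO C 1 E) = \<delta> E" if E: "indecomposable C E" for E
  proof -
    \<comment> \<open>A path from \<open>E\<close> to \<open>E[1]\<close> has the same degree for
      both gradings, so \<open>key\<close> gives difference 0.\<close>
    obtain l where l: "zigzag C E l (shO C 1 E)" "homogeneous_path (gr R) l"
      using conn E shift_indecomposable[OF E] unfolding connective_def connecting_path_def by blast
    then show ?thesis using key[OF l] shift_path_deg_eq[OF l] by simp
  qed
  moreover have "[phase R' E = phase R E + \<delta> E] (rmod 2)" if E: "indecomposable C E" for E
  proof -
    have "[path_deg (gr R') (P E) = phase R' E - phase R' E0] (rmod 2)"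
      using path_deg_phase[OF triple(2)] P[OF E] homogeneous_path_iff by blast
    from rcong_diff[OF this path_deg_phase[OF triple(1) P[OF E]]]
    \<comment> \<open>The left side is \<open>phase R E + \<delta> E\<close>; the right side
      collapses to \<open>phase R' E\<close>.\<close>
    have "[phase R E + (phase R' E0 - phase R E0) + (path_deg (gr R') (P E) - path_deg (gr R) (P E)) =
        phase R E + (phase R' E0 - phase R E0) +
          ((phase R' E - phase R' E0) - (phase R E - phase R E0))] (rmod 2)"
      by (intro rcong_add rcong_refl)
    then show ?thesis by (simp add: \<delta>_def rcong_sym algebra_simps)
  qed
  ultimately show ?thesis unfolding potential_def by blast
qed

end

section \<open>Comparison of the lifts\<close>

text \<open>The underlying direct sum stays untouched, so the projections to \<open>C\<close> agree
  strictly.\<close>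

definition regrade :: "('o \<Rightarrow> real) \<Rightarrow> ('o, 'm) lobj \<Rightarrow> ('o, 'm) lobj" where
  "regrade \<delta> = (\<lambda>(X, \<theta>). (X, map2 (\<lambda>p t. t + \<delta> (fst p)) (parts X) \<theta>))"

definition regrade_functor :: "('o \<Rightarrow> real) \<Rightarrow> (('o, 'm) lobj, 'm, ('o, 'm) lobj, 'm) functr" where
  "regrade_functor \<delta> = \<lparr>onO = regrade \<delta>, onM = id\<rparr>"

lemma fst_regrade [simp]: "fst (regrade \<delta> X) = fst X"
  by (simp add: regrade_def split: prod.splits)

lemma lift_obj_tot: "X \<in> lift_obj C R \<Longrightarrow> tot (fst X) \<in> Obj C"
  by (auto simp: lift_obj_def decomposed_def biproduct_def)

lemma lift_arr_arr: "f \<in> lift_arr C R X Y \<Longrightarrow> f \<in> arr C (tot (fst X)) (tot (fst Y))"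
  by (auto simp: lift_arr_def split: prod.splits)

lemma regrade_lift_obj:
  assumes pot: "potential C R R' \<delta>" and X: "X \<in> lift_obj C R"
  shows "regrade \<delta> X \<in> lift_obj C R'"
proof -
  obtain D \<theta> where X': "X = (D, \<theta>)" by (cases X)
  have D: "decomposed C D" "length \<theta> = length (parts D)"
    "\<And>i. i < length \<theta> \<Longrightarrow> [\<theta> ! i = phase R (summand D i)] (rmod 2)"
    using X by (auto simp: X' lift_obj_def)
  have "[\<theta> ! i + \<delta> (summand D i) = phase R' (summand D i)] (rmod 2)" if i: "i < length \<theta>" for i
  proof -
    have "[phase R' (summand D i) = phase R (summand D i) + \<delta> (summand D i)] (rmod 2)"
      using pot D(1,2) i by (simp add: potential_def decomposed_def)
    moreover have "[\<theta> ! i + \<delta> (summand D i) = phase R (summand D i) + \<delta> (summand D i)] (rmod 2)"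
      using D(3)[OF i] by simp
    ultimately show ?thesis using rcong_sym rcong_trans by blast
  qed
  then show ?thesis using D by (simp add: X' regrade_def lift_obj_def summand_def)
qed

text \<open>Regrading changes the prescribed degree of a component by
  \<open>\<delta> F - \<delta> E\<close>, exactly the discrepancy between the two gradings.\<close>

lemma regrade_lift_arr:
  assumes pot: "potential C R R' \<delta>" and X: "X \<in> lift_obj C R" and Y: "Y \<in> lift_obj C R"
  shows "lift_arr C R' (regrade \<delta> X) (regrade \<delta> Y) = lift_arr C R X Y"
proof -
  obtain D \<theta> where X': "X = (D, \<theta>)" by (cases X)
  obtain D' \<eta> where Y': "Y = (D', \<eta>)" by (cases Y)
  have D: "decomposed C D" "length \<theta> = length (parts D)"
    and D': "decomposed C D'" "length \<eta> = length (parts D')"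
    using X Y by (auto simp: X' Y' lift_obj_def)
  have "gr R' (summand D i) (summand D' j)
      ((\<eta> ! j + \<delta> (summand D' j)) - (\<theta> ! i + \<delta> (summand D i))) =
      gr R (summand D i) (summand D' j) (\<eta> ! j - \<theta> ! i)"
    if "i < length (parts D)" "j < length (parts D')" for i j
  proof -
    have "gr R' (summand D i) (summand D' j)
        ((\<eta> ! j - \<theta> ! i) + \<delta> (summand D' j) - \<delta> (summand D i)) =
        gr R (summand D i) (summand D' j) (\<eta> ! j - \<theta> ! i)"
      using pot D(1) D'(1) that unfolding potential_def decomposed_def by blast
    then show ?thesis by (simp add: algebra_simps)
  qed
  then show ?thesis
    using D(2) D'(2) by (auto simp: X' Y' lift_arr_def regrade_def summand_def)
qed

text \<open>There are as many phases as parts, so \<open>map2\<close> truncates nothing and the two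
  corrections cancel entrywise.\<close>

lemma regrade_inverse:
  assumes "X \<in> lift_obj C R"
  shows "regrade (\<lambda>E. - \<delta> E) (regrade \<delta> X) = X"
  using assms by (auto simp: lift_obj_def regrade_def intro: nth_equalityI)

text \<open>Rests on the invariance of \<open>\<delta>\<close> under \<open>[1]\<close>; strict
  commutation lets identities serve as the comparison with the shift.\<close>

lemma regrade_shift:
  assumes pot: "potential C R R' \<delta>" and X: "X \<in> lift_obj C R"
  shows "regrade \<delta> (lift_sh C 1 X) = lift_sh C 1 (regrade \<delta> X)"
proof -
  obtain D \<theta> where X': "X = (D, \<theta>)" by (cases X)
  have D: "decomposed C D" "length \<theta> = length (parts D)" using X by (auto simp: X' lift_obj_def)
  have "\<delta> (shO C 1 (summand D i)) = \<delta> (summand D i)" if "i < length (parts D)" for i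
    using pot D(1) that by (simp add: potential_def decomposed_def)
  then have "\<delta> (shO C 1 E) = \<delta> E" if "parts D ! i = (E, \<iota>, \<rho>)" "i < length (parts D)" for i E \<iota> \<rho>
    using that by (metis fst_conv summand_def)
  then show ?thesis
    using D(2)
    by (auto simp: X' regrade_def lift_sh_def shD_def intro!: nth_equalityI split: prod.splits)
qed

lemma zlift_simps [simp]:
  "Obj (zlift C R) = lift_obj C R"
  "arr (zlift C R) X Y = lift_arr C R X Y"
  "ident (zlift C R) X = ident C (tot (fst X))"
  "cmp (zlift C R) = cmp C"
  "shO (zlift C R) = lift_sh C"
  "shM (zlift C R) = shM C"
  "f \<oplus>\<^bsub>hom_mod (zlift C R) X Y\<^esub> g = f \<oplus>\<^bsub>hom_mod C (tot (fst X)) (tot (fst Y))\<^esub> g"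
  "c \<odot>\<^bsub>hom_mod (zlift C R) X Y\<^esub> f = c \<odot>\<^bsub>hom_mod C (tot (fst X)) (tot (fst Y))\<^esub> f"
  by (simp_all add: zlift_def)

lemma regrade_linear_functor:
  assumes "potential C R R' \<delta>"
  shows "linear_functor K (zlift C R) (zlift C R') (regrade_functor \<delta>)"
  using regrade_lift_obj[OF assms] regrade_lift_arr[OF assms]
  by (simp add: linear_functor_def regrade_functor_def)

section \<open>Identities in the lift and the triangulated equivalence\<close>

context cyclic_category
begin

text \<open>Diagonal components are identities, of degree 0; the others are zero and lie in every
  graded piece.\<close>

lemma lift_ident:
  assumes R: "is_charge_triple K C L v R" and X: "X \<in> lift_obj C R"
  shows "ident C (tot (fst X)) \<in> lift_arr C R X X"
proof -
  obtain D \<theta> where X': "X = (D, \<theta>)" by (cases X)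
  have D: "decomposed C D" using X by (simp add: X' lift_obj_def)
  have G: "real_decomposition K C (gr R)" using R by (simp add: is_charge_triple_def)
  have "component C D D (ident C (tot D)) i j \<in> gr R (summand D i) (summand D j) (\<theta> ! j - \<theta> ! i)"
    if "i < length (parts D)" "j < length (parts D)" for i j
    using component_ident[OF D that] decomposed_summand[OF D] that
      real_decompositionD(4)[OF G] grading_submodule(2)[OF G] by simp
  then show ?thesis
    using ident_closed[OF decomposed_Obj[OF D]] by (simp add: X' lift_arr_def)
qed

lemma lift_sh_obj:
  assumes R: "is_charge_triple K C L v R" and X: "X \<in> lift_obj C R"
  shows "lift_sh C 1 X \<in> lift_obj C R"
proof -
  obtain D \<theta> where X': "X = (D, \<theta>)" by (cases X)
  have D: "decomposed C D" "length \<theta> = length (parts D)"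
    "\<And>i. i < length \<theta> \<Longrightarrow> [\<theta> ! i = phase R (summand D i)] (rmod 2)"
    using X by (auto simp: X' lift_obj_def)
  have "[\<theta> ! i + 1 = phase R (shO C 1 (summand D i))] (rmod 2)" if i: "i < length \<theta>" for i
  proof -
    have "[phase R (shO C 1 (summand D i)) = phase R (summand D i) + 1] (rmod 2)"
      using R decomposed_summand[OF D(1), of i] D(2) i by (simp add: is_charge_triple_def)
    moreover have "[\<theta> ! i + 1 = phase R (summand D i) + 1] (rmod 2)"
      using D(3)[OF i] by simp
    ultimately show ?thesis using rcong_sym rcong_trans by blast
  qed
  moreover have "summand (shD C 1 D) i = shO C 1 (summand D i)" if "i < length (parts D)" for i
    using that by (simp add: shD_def summand_def split: prod.splits)
  moreover have "length (parts (shD C 1 D)) = length (parts D)" by (simp add: shD_def)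
  ultimately show ?thesis
    using D(2) shift_decomposed[OF D(1)] by (simp add: X' lift_sh_def lift_obj_def)
qed

text \<open>Functors that agree strictly are related by identities. This serves both composites of
  the regradings and the compatibility with the shift.\<close>

lemma zlift_natural_iso_ident:
  assumes R: "is_charge_triple K C L v R"
    and O: "\<And>X. X \<in> Obj S \<Longrightarrow> onO F X \<in> lift_obj C R \<and> onO G X = onO F X"
    and M: "\<And>X Y f. X \<in> Obj S \<Longrightarrow> Y \<in> Obj S \<Longrightarrow> f \<in> arr S X Y \<Longrightarrow>
      onM F f \<in> arr C (tot (fst (onO F X))) (tot (fst (onO F Y))) \<and> onM G f = onM F f"
  shows "natural_iso S (zlift C R) F G (\<lambda>X. ident C (tot (fst (onO F X))))"
  unfolding natural_iso_def
proof (intro conjI ballI)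
  fix X assume X: "X \<in> Obj S"
  have T: "tot (fst (onO F X)) \<in> Obj C"
    using O[OF X] lift_obj_tot by blast
  then show "is_isom (zlift C R) (onO F X) (onO G X) (ident C (tot (fst (onO F X))))"
    using O[OF X] lift_ident[OF R, of "onO F X"] cmp_ident_left[OF T T ident_closed[OF T]]
    unfolding is_isom_def zlift_simps by metis
  fix Y f assume Y: "Y \<in> Obj S" and f: "f \<in> arr S X Y"
  have T': "tot (fst (onO F Y)) \<in> Obj C"
    using O[OF Y] lift_obj_tot by blast
  show "ident C (tot (fst (onO F Y))) \<cdot>\<^bsub>zlift C R\<^esub> onM F f =
      onM G f \<cdot>\<^bsub>zlift C R\<^esub> ident C (tot (fst (onO F X)))"
    using M[OF X Y f] cmp_ident_left[OF T T'] cmp_ident_right[OF T T'] by simp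
qed

lemma regrade_equivalence:
  assumes R: "is_charge_triple K C L v R" and R': "is_charge_triple K C L v R'"
    and pot: "potential C R R' \<delta>"
  shows "triangulated_equivalence K (zlift C R) (zlift C R') (regrade_functor \<delta>)"
  unfolding triangulated_equivalence_def linear_equivalence_def
proof (intro conjI exI)
  let ?F = "regrade_functor \<delta>" and ?G = "regrade_functor (\<lambda>E. - \<delta> E)"
  note pot' = potential_sym[OF pot]
  show "linear_functor K (zlift C R) (zlift C R') ?F" "linear_functor K (zlift C R') (zlift C R) ?G"
    using regrade_linear_functor pot pot' by blast+
  show "natural_iso (zlift C R) (zlift C R) (comp_functor ?G ?F) id_functor
      (\<lambda>X. ident C (tot (fst (onO (comp_functor ?G ?F) X))))"
    by (rule zlift_natural_iso_ident[OF R])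
      (auto simp: comp_functor_def id_functor_def regrade_functor_def regrade_inverse
        dest: lift_arr_arr)
  show "natural_iso (zlift C R') (zlift C R') (comp_functor ?F ?G) id_functor
      (\<lambda>X. ident C (tot (fst (onO (comp_functor ?F ?G) X))))"
    using regrade_inverse[of _ C R' "\<lambda>E. - \<delta> E"]
    by (intro zlift_natural_iso_ident[OF R'])
      (auto simp: comp_functor_def id_functor_def regrade_functor_def dest: lift_arr_arr)
  let ?FS = "comp_functor ?F (shift_functor (zlift C R) 1)"
    and ?SF = "comp_functor (shift_functor (zlift C R') 1) ?F"
  have tot_sh: "tot (fst (lift_sh C 1 X)) = shO C 1 (tot (fst X))" for X :: "('o, 'm) lobj"
    by (simp add: lift_sh_def shD_def split: prod.splits)
  show "natural_iso (zlift C R) (zlift C R') ?FS ?SF (\<lambda>X. ident C (tot (fst (onO ?FS X))))"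
  proof (rule zlift_natural_iso_ident[OF R'])
    show "onO ?FS X \<in> lift_obj C R' \<and> onO ?SF X = onO ?FS X" if "X \<in> Obj (zlift C R)" for X
      using that regrade_shift[OF pot, of X] lift_sh_obj[OF R, of X]
        regrade_lift_obj[OF pot, of "lift_sh C 1 X"]
      by (simp add: comp_functor_def shift_functor_def regrade_functor_def)
    show "onM ?FS f \<in> arr C (tot (fst (onO ?FS X))) (tot (fst (onO ?FS Y))) \<and> onM ?SF f = onM ?FS f"
      if "X \<in> Obj (zlift C R)" "Y \<in> Obj (zlift C R)" "f \<in> arr (zlift C R) X Y" for X Y f
      using that shift_arr[of "tot (fst X)" "tot (fst Y)" f 1] lift_obj_tot[of X C R] lift_obj_tot[of Y C R]
        lift_arr_arr[of f C R X Y]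
      by (simp add: comp_functor_def shift_functor_def regrade_functor_def tot_sh)
  qed
  show "\<forall>X Y Z f g h. (X, Y, Z, f, g, h) \<in> dist (zlift C R) \<longrightarrow>
      (onO ?F X, onO ?F Y, onO ?F Z, onM ?F f, onM ?F g,
        ident C (tot (fst (onO ?FS X))) \<cdot>\<^bsub>zlift C R'\<^esub> onM ?F h) \<in> dist (zlift C R')"
  proof (intro allI impI)
    fix X Y Z f g h assume "(X, Y, Z, f, g, h) \<in> dist (zlift C R)"
    then have XYZ: "X \<in> lift_obj C R" "Y \<in> lift_obj C R" "Z \<in> lift_obj C R"
      and fgh: "f \<in> lift_arr C R X Y" "g \<in> lift_arr C R Y Z" "h \<in> lift_arr C R Z (lift_sh C 1 X)"
      and tri: "(tot (fst X), tot (fst Y), tot (fst Z), f, g, h) \<in> dist C"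
      by (auto simp: zlift_def)
    \<comment> \<open>The comparison isomorphism is an identity, so the third map of the triangle
      remains \<open>h\<close>.\<close>
    have "ident C (shO C 1 (tot (fst X))) \<cdot>\<^bsub>C\<^esub> h = h"
      using cmp_ident_left[OF lift_obj_tot[OF XYZ(3)] shift_Obj[OF lift_obj_tot[OF XYZ(1)]]]
        lift_arr_arr[OF fgh(3)] by (simp add: tot_sh)
    moreover have "h \<in> lift_arr C R' (regrade \<delta> Z) (lift_sh C 1 (regrade \<delta> X))"
      using fgh(3) regrade_lift_arr[OF pot XYZ(3) lift_sh_obj[OF R XYZ(1)]]
        regrade_shift[OF pot XYZ(1)] by simp
    ultimately show "(onO ?F X, onO ?F Y, onO ?F Z, onM ?F f, onM ?F g,
        ident C (tot (fst (onO ?FS X))) \<cdot>\<^bsub>zlift C R'\<^esub> onM ?F h) \<in> dist (zlift C R')"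
      using fgh(1,2) tri regrade_lift_arr[OF pot] regrade_lift_obj[OF pot] XYZ
      by (simp add: zlift_def regrade_functor_def comp_functor_def shift_functor_def tot_sh)
  qed
qed

end

theorem proposition1p2:
  fixes K :: "('k, 'r) ring_scheme"
    and C :: "('o, 'm, 'k) cyccat"
    and L :: "('l, 'x) monoid_scheme"
    and v :: "('o \<Rightarrow>\<^sub>0 int) set \<Rightarrow> 'l"
    and R\<^sub>1 R\<^sub>2 :: "('o, 'm) charge_triple"
  assumes "cyclic_category K C"
    and "krull_schmidt C"
    and "lattice_group L"
    and "v \<in> hom (K0 C) L"
    and "is_charge_triple K C L v R\<^sub>1"
    and "is_charge_triple K C L v R\<^sub>2"
    and "connective C (gr R\<^sub>1)"
    and "deformation_equivalent C R\<^sub>1 R\<^sub>2"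
    and "liftable C R\<^sub>1"
  shows "liftable C R\<^sub>2 \<and>
    (\<exists>H. triangulated_equivalence K (zlift C R\<^sub>1) (zlift C R\<^sub>2) H \<and>
         functor_eq_on (zlift C R\<^sub>1) (comp_functor lift_proj H) lift_proj)"
proof -
  interpret cyclic_category K C by fact
  interpret deformation K C L v R\<^sub>1 R\<^sub>2
    using assms by unfold_locales
  \<comment> \<open>Here a non-canonical choice enters: adding an even integer to
    \<open>\<delta>\<close> gives another potential.\<close>
  obtain \<delta> where \<delta>: "potential C R\<^sub>1 R\<^sub>2 \<delta>"
    using exists_potential assms(7) by blast
  have "functor_eq_on (zlift C R\<^sub>1) (comp_functor lift_proj (regrade_functor \<delta>)) lift_proj"
    by (simp add: functor_eq_on_def comp_functor_def lift_proj_def regrade_functor_def)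
  then show ?thesis
    using liftable_deformation assms(9) regrade_equivalence[OF assms(5,6) \<delta>] by blast
qed

end
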